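(* Let $G$ be a hyperbolic group and suppose that $G$ admits a uniform action on $\mathbb{R}$. Then there is a zipper $Z^\pm\subset\partial_\infty G$ for $G$.
   Context: A zipper for a hyperbolic group $G$ with Gromov boundary $\partial_\infty G$ is a pair $Z^\pm$ of nonempty, path-connected, disjoint, $G$-invariant subsets of $\partial_\infty G$. Fix a finite symmetric generating set $S$ for $G$, and let $d$ be the (left-invariant) word metric on $G$ induced by $S$, so $d(x,y)$ is the $S$-word length of $x^{-1}y$. An orientation-preserving action of $G$ on $\mathbb{R}$ (by homeomorphisms) is almost periodic if (1) there is a constant $K$ so that every $s\in S$ acts by a $K$-bilipschitz homeomorphism; (2) there is a constant $C$ so that $|s(p)-p|\le C$ for all $p\in\mathbb{R}$ and all $s\in S$; and (3) for all $p\in\mathbb{R}$ there are $s^+,s^-\in S$ with $s^+(p)-p\ge 1$ and $s^-(p)-p\le -1$. Given an almost periodic action, an element $g\in G$ is an up element (universally positive) if there is a constant $C(g)>0$ so that $g^{-1}(p)-p\ge C(g)$ for all $p\in\mathbb{R}$. A faithful orientation-preserving action of $G$ on $\mathbb{R}$ is up uniform if it is almost periodic, and there is a constant $C\ge 1$ such that for any two elements $x,y\in G$ with $d(x,y)\le 2C$ there is a $z\in G$ and two finite sequences $x=x_0,\dots,x_{m_1}=z$ and $y=y_0,\dots,y_{m_2}=z$ of elements of $G$ such that (1) $d(x_i,x_{i+1})\le C$ and $d(y_i,y_{i+1})\le C$ for all $i$; and (2) each $x_i^{-1}x_{i+1}$ and each $y_i^{-1}y_{i+1}$ is an up element. The opposite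 action is obtained from the given action by conjugating by an orientation-reversing homeomorphism of $\mathbb{R}$. An action is uniform if it is up uniform and the opposite action is also up uniform (possibly with different constants). *)

theory Defs
  imports "HOL-Analysis.Analysis" "HOL-Algebra.Generated_Groups" "HOL-Algebra.Group_Action"
begin

section \<open>Word metrics and hyperbolic groups\<close>

definition symmetric_generating_set :: "('a, 'b) monoid_scheme \<Rightarrow> 'a set \<Rightarrow> bool" where
  "symmetric_generating_set G S \<longleftrightarrow>
     finite S \<and> S \<subseteq> carrier G \<and> (\<forall>s\<in>S. inv\<^bsub>G\<^esub> s \<in> S) \<and> generate G S = carrier G"

definition word_length :: "('a, 'b) monoid_scheme \<Rightarrow> 'a set \<Rightarrow> 'a \<Rightarrow> nat" where
  "word_length G S g =
     (LEAST n. \<exists>w. set w \<subseteq> S \<and> length w = n \<and> foldr (\<otimes>\<^bsub>G\<^esub>) w \<one>\<^bsub>G\<^esub> = g)"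

definition word_dist :: "('a, 'b) monoid_scheme \<Rightarrow> 'a set \<Rightarrow> 'a \<Rightarrow> 'a \<Rightarrow> real" where
  "word_dist G S x y = real (word_length G S (inv\<^bsub>G\<^esub> x \<otimes>\<^bsub>G\<^esub> y))"

text \<open>The first point argument is the base point.\<close>

definition gromov_product ::
    "('a, 'b) monoid_scheme \<Rightarrow> 'a set \<Rightarrow> 'a \<Rightarrow> 'a \<Rightarrow> 'a \<Rightarrow> real" where
  "gromov_product G S e x y = (word_dist G S e x + word_dist G S e y - word_dist G S x y) / 2"

definition hyperbolic_group :: "('a, 'b) monoid_scheme \<Rightarrow> bool" where
  "hyperbolic_group G \<longleftrightarrow> group G \<and>
     (\<exists>S. symmetric_generating_set G S \<and>
       (\<exists>\<delta>\<ge>0. \<forall>e\<in>carrier G. \<forall>x\<in>carrier G. \<forall>y\<in>carrier G. \<forall>z\<in>carrier G.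
          gromov_product G S e x z
            \<ge> min (gromov_product G S e x y) (gromov_product G S e y z) - \<delta>))"


section \<open>The Gromov boundary\<close>

text \<open>
  Boundary points are equivalence classes of sequences converging to infinity. The definitions
  make sense for every generating set; for a hyperbolic group they give the usual boundary,
  which up to canonical equivariant homeomorphism does not depend on the generating set.
\<close>

definition converging_at_infinity ::
    "('a, 'b) monoid_scheme \<Rightarrow> 'a set \<Rightarrow> (nat \<Rightarrow> 'a) \<Rightarrow> bool" where
  "converging_at_infinity G S x \<longleftrightarrow> range x \<subseteq> carrier G \<and>
     filterlim (\<lambda>(i, j). gromov_product G S \<one>\<^bsub>G\<^esub> (x i) (x j)) at_top
       (sequentially \<times>\<^sub>F sequentially)"

definition boundary_rel ::
    "('a, 'b) monoid_scheme \<Rightarrow> 'a set \<Rightarrow> ((nat \<Rightarrow> 'a) \<times> (nat \<Rightarrow> 'a)) set" where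
  "boundary_rel G S =
     {(x, y). converging_at_infinity G S x \<and> converging_at_infinity G S y \<and>
        filterlim (\<lambda>(i, j). gromov_product G S \<one>\<^bsub>G\<^esub> (x i) (y j)) at_top
          (sequentially \<times>\<^sub>F sequentially)}"

definition gromov_boundary :: "('a, 'b) monoid_scheme \<Rightarrow> 'a set \<Rightarrow> (nat \<Rightarrow> 'a) set set" where
  "gromov_boundary G S = {x. converging_at_infinity G S x} // boundary_rel G S"

definition boundary_nbhd ::
    "('a, 'b) monoid_scheme \<Rightarrow> 'a set \<Rightarrow> (nat \<Rightarrow> 'a) set \<Rightarrow> real \<Rightarrow> (nat \<Rightarrow> 'a) set set" where
  "boundary_nbhd G S \<xi> r =
     {\<eta> \<in> gromov_boundary G S. \<exists>x\<in>\<xi>. \<exists>y\<in>\<eta>.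
        Liminf (sequentially \<times>\<^sub>F sequentially)
          (\<lambda>(i, j). ereal (gromov_product G S \<one>\<^bsub>G\<^esub> (x i) (y j))) \<ge> ereal r}"

text \<open>The sets \<open>boundary_nbhd G S \<xi> r\<close> form a neighbourhood base at \<open>\<xi>\<close>.\<close>

definition boundary_topology ::
    "('a, 'b) monoid_scheme \<Rightarrow> 'a set \<Rightarrow> (nat \<Rightarrow> 'a) set topology" where
  "boundary_topology G S =
     topology (\<lambda>U. U \<subseteq> gromov_boundary G S \<and> (\<forall>\<xi>\<in>U. \<exists>r. boundary_nbhd G S \<xi> r \<subseteq> U))"

lemma boundary_nbhd_antimono: "r \<le> r' \<Longrightarrow> boundary_nbhd G S \<xi> r' \<subseteq> boundary_nbhd G S \<xi> r"
proof -
  assume "r \<le> r'"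
  then have "ereal r' \<le> L \<Longrightarrow> ereal r \<le> L" for L
    using order_trans[of "ereal r" "ereal r'" L] by simp
  then show ?thesis
    unfolding boundary_nbhd_def by fast
qed

lemma openin_boundary_topology:
  "openin (boundary_topology G S) U \<longleftrightarrow>
     U \<subseteq> gromov_boundary G S \<and> (\<forall>\<xi>\<in>U. \<exists>r. boundary_nbhd G S \<xi> r \<subseteq> U)"
proof -
  let ?L = "\<lambda>U. U \<subseteq> gromov_boundary G S \<and> (\<forall>\<xi>\<in>U. \<exists>r. boundary_nbhd G S \<xi> r \<subseteq> U)"
  have "?L (U \<inter> V)" if U: "?L U" and V: "?L V" for U V
  proof (intro conjI ballI)
    show "U \<inter> V \<subseteq> gromov_boundary G S" using U by blast
    fix \<xi> assume "\<xi> \<in> U \<inter> V"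
    then obtain r r' where "boundary_nbhd G S \<xi> r \<subseteq> U" "boundary_nbhd G S \<xi> r' \<subseteq> V"
      using U V by blast
    then have "boundary_nbhd G S \<xi> (max r r') \<subseteq> U \<inter> V"
      using boundary_nbhd_antimono[of r "max r r'" G S \<xi>] boundary_nbhd_antimono[of r' "max r r'" G S \<xi>]
      by auto
    then show "\<exists>r. boundary_nbhd G S \<xi> r \<subseteq> U \<inter> V" ..
  qed
  moreover have "?L (\<Union>K)" if K: "\<forall>U\<in>K. ?L U" for K
  proof (intro conjI ballI)
    show "\<Union>K \<subseteq> gromov_boundary G S" using K by blast
    fix \<xi> assume "\<xi> \<in> \<Union>K"
    then obtain U where "U \<in> K" "\<xi> \<in> U" ..
    then obtain r where "boundary_nbhd G S \<xi> r \<subseteq> U" using K by blast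
    with \<open>U \<in> K\<close> show "\<exists>r. boundary_nbhd G S \<xi> r \<subseteq> \<Union>K" by blast
  qed
  ultimately have "istopology ?L"
    unfolding istopology_def by presburger
  then show ?thesis
    by (simp add: boundary_topology_def topology_inverse')
qed

lemma topspace_boundary_topology: "topspace (boundary_topology G S) = gromov_boundary G S"
proof
  show "topspace (boundary_topology G S) \<subseteq> gromov_boundary G S"
    using openin_boundary_topology[of G S "topspace (boundary_topology G S)"] by blast
  have "openin (boundary_topology G S) (gromov_boundary G S)"
    by (auto simp: openin_boundary_topology boundary_nbhd_def)
  then show "gromov_boundary G S \<subseteq> topspace (boundary_topology G S)"
    by (rule openin_subset)
qed

definition boundary_act ::
    "('a, 'b) monoid_scheme \<Rightarrow> 'a \<Rightarrow> (nat \<Rightarrow> 'a) set \<Rightarrow> (nat \<Rightarrow> 'a) set" where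
  "boundary_act G g \<xi> = (\<lambda>x n. g \<otimes>\<^bsub>G\<^esub> x n) ` \<xi>"

definition zipper ::
    "('a, 'b) monoid_scheme \<Rightarrow> 'a set \<Rightarrow> (nat \<Rightarrow> 'a) set set \<Rightarrow> (nat \<Rightarrow> 'a) set set \<Rightarrow> bool" where
  "zipper G S Zp Zm \<longleftrightarrow>
     Zp \<subseteq> gromov_boundary G S \<and> Zm \<subseteq> gromov_boundary G S \<and>
     Zp \<noteq> {} \<and> Zm \<noteq> {} \<and> Zp \<inter> Zm = {} \<and>
     path_connectedin (boundary_topology G S) Zp \<and>
     path_connectedin (boundary_topology G S) Zm \<and>
     (\<forall>g\<in>carrier G. boundary_act G g ` Zp = Zp) \<and>
     (\<forall>g\<in>carrier G. boundary_act G g ` Zm = Zm)"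


section \<open>Uniform actions on the line\<close>

definition orientation_preserving_action ::
    "('a, 'b) monoid_scheme \<Rightarrow> ('a \<Rightarrow> real \<Rightarrow> real) \<Rightarrow> bool" where
  "orientation_preserving_action G \<rho> \<longleftrightarrow> group_action G UNIV \<rho> \<and>
     (\<forall>g\<in>carrier G. (\<exists>f. homeomorphism UNIV UNIV (\<rho> g) f) \<and> strict_mono (\<rho> g))"

definition bilipschitz :: "real \<Rightarrow> (real \<Rightarrow> real) \<Rightarrow> bool" where
  "bilipschitz K f \<longleftrightarrow> K \<ge> 1 \<and>
     (\<forall>p q. dist p q / K \<le> dist (f p) (f q) \<and> dist (f p) (f q) \<le> K * dist p q)"

definition almost_periodic ::
    "('a, 'b) monoid_scheme \<Rightarrow> 'a set \<Rightarrow> ('a \<Rightarrow> real \<Rightarrow> real) \<Rightarrow> bool" where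
  "almost_periodic G S \<rho> \<longleftrightarrow> orientation_preserving_action G \<rho> \<and>
     (\<exists>K. \<forall>s\<in>S. bilipschitz K (\<rho> s)) \<and>
     (\<exists>C. \<forall>p. \<forall>s\<in>S. \<bar>\<rho> s p - p\<bar> \<le> C) \<and>
     (\<forall>p. \<exists>sp\<in>S. \<exists>sm\<in>S. \<rho> sp p - p \<ge> 1 \<and> \<rho> sm p - p \<le> -1)"

definition up_element ::
    "('a, 'b) monoid_scheme \<Rightarrow> ('a \<Rightarrow> real \<Rightarrow> real) \<Rightarrow> 'a \<Rightarrow> bool" where
  "up_element G \<rho> g \<longleftrightarrow> g \<in> carrier G \<and> (\<exists>c>0. \<forall>p. \<rho> (inv\<^bsub>G\<^esub> g) p - p \<ge> c)"

text \<open>A path may be constant (\<open>m = 0\<close>).\<close>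

definition up_path ::
    "('a, 'b) monoid_scheme \<Rightarrow> 'a set \<Rightarrow> ('a \<Rightarrow> real \<Rightarrow> real) \<Rightarrow> real \<Rightarrow> 'a \<Rightarrow> 'a \<Rightarrow> bool" where
  "up_path G S \<rho> C x z \<longleftrightarrow>
     (\<exists>m (u :: nat \<Rightarrow> 'a). u 0 = x \<and> u m = z \<and> (\<forall>i\<le>m. u i \<in> carrier G) \<and>
        (\<forall>i<m. word_dist G S (u i) (u (Suc i)) \<le> C \<and>
               up_element G \<rho> (inv\<^bsub>G\<^esub> (u i) \<otimes>\<^bsub>G\<^esub> u (Suc i))))"

definition up_uniform ::
    "('a, 'b) monoid_scheme \<Rightarrow> 'a set \<Rightarrow> ('a \<Rightarrow> real \<Rightarrow> real) \<Rightarrow> bool" where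
  "up_uniform G S \<rho> \<longleftrightarrow> faithful_action G UNIV \<rho> \<and> almost_periodic G S \<rho> \<and>
     (\<exists>C\<ge>1. \<forall>x\<in>carrier G. \<forall>y\<in>carrier G. word_dist G S x y \<le> 2 * C \<longrightarrow>
        (\<exists>z\<in>carrier G. up_path G S \<rho> C x z \<and> up_path G S \<rho> C y z))"

definition opposite_action :: "('a \<Rightarrow> real \<Rightarrow> real) \<Rightarrow> ('a \<Rightarrow> real \<Rightarrow> real) \<Rightarrow> bool" where
  "opposite_action \<rho> \<rho>' \<longleftrightarrow>
     (\<exists>h h'. homeomorphism UNIV UNIV h h' \<and> (\<forall>p q. p < q \<longrightarrow> h q < h p) \<and>
        \<rho>' = (\<lambda>g. h \<circ> \<rho> g \<circ> h'))"

text \<open>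
  The opposite action is only defined up to conjugacy by an orientation-preserving homeomorphism,
  and almost periodicity is not invariant under such conjugacies. So we ask for some
  representative; taking \<open>h p = - p\<close> in \<open>opposite_action\<close> gives the reflected action.
\<close>

definition uniform_action ::
    "('a, 'b) monoid_scheme \<Rightarrow> 'a set \<Rightarrow> ('a \<Rightarrow> real \<Rightarrow> real) \<Rightarrow> bool" where
  "uniform_action G S \<rho> \<longleftrightarrow>
     up_uniform G S \<rho> \<and> (\<exists>\<rho>'. opposite_action \<rho> \<rho>' \<and> up_uniform G S \<rho>')"

end

theory Submission
  imports Defs "HOL-Real_Asymp.Real_Asymp"
begin

text \<open>
  Call \<open>x \<rightarrow> y\<close> an up step if \<open>x\<^sup>-\<^sup>1 y\<close> is a short up element. The height \<open>x \<mapsto> x\<^sup>-\<^sup>1(p)\<close> is Lipschitz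
  for the word metric and grows by a definite amount along every up step, so infinite paths of up
  steps are quasigeodesic rays and have endpoints on the boundary. Let \<open>Z\<^sup>+\<close> be the set of these
  endpoints, and \<open>Z\<^sup>-\<close> the same set for the opposite action.

  Disjointness: an up ray and a down ray cannot have the same endpoint, because running down one
  and up the other is again a quasigeodesic. Path-connectedness: given two up rays from the same point, up
  uniformity provides up paths from their second points to a common vertex, hence two
  new rays with a common endpoint, each of which shares its first two points with one of the given
  rays. Iterating this subdivides the pair into
  pairs that branch later and later, and these converge to a continuous path of endpoints, each
  of which is again the endpoint of an up ray.
\<close>

section \<open>Stability of quasigeodesics\<close>

text \<open>Two things shape the argument. Hyperbolicity is given for some generating set, while the
  boundary and the steps refer to \<open>S\<close>; so what is used of it is condensed into one
  statement about the metric of \<open>S\<close>: along a quasigeodesic, a detour through an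
  intermediate vertex costs a bounded amount. Moreover, this bound has to be uniform over all rays,
  since a path of endpoints compares infinitely many of them. There are only finitely many short up
  elements, hence a common height gain \<open>c\<close>, and two rays from a common start that agree
  at step \<open>n\<close> have Gromov product at least \<open>c * n\<close> minus a constant from
  then on.

  Each point of the path comes from a branch of a binary tree whose edges are up steps, so it is the
  endpoint of an up ray by construction. What remains is gluing: a dyadic point is reached by one
  branch from each side, and the merging rays give both the same endpoint. The bound
  \<open>2 * C\<close> in up uniformity is the largest distance between the ends of two steps from
  one vertex.\<close>

lemma linear_le_log_bounded:
  fixes l c b :: real
  assumes "l > 0" "b > 0"
  obtains M where "\<And>D. D \<le> l + (log 2 (l * (6 * D + 2) + c) + 3) * b \<Longrightarrow> D \<le> M"
proof -
  have "filterlim (\<lambda>D. D - (l + (log 2 (l * (6 * D + 2) + c) + 3) * b)) at_top at_top"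
    using assms by real_asymp
  then have "eventually (\<lambda>D. 1 \<le> D - (l + (log 2 (l * (6 * D + 2) + c) + 3) * b)) at_top"
    by (simp add: filterlim_at_top)
  then obtain M where "\<And>D. D \<ge> M \<Longrightarrow> 1 \<le> D - (l + (log 2 (l * (6 * D + 2) + c) + 3) * b)"
    by (auto simp: eventually_at_top_linorder)
  then have "D \<le> M" if "D \<le> l + (log 2 (l * (6 * D + 2) + c) + 3) * b" for D
    using that by (smt (verit))
  with that show ?thesis by blast
qed

locale hyperbolic_metric =
  fixes X :: "'a set" and d :: "'a \<Rightarrow> 'a \<Rightarrow> real" and \<delta> :: real
  assumes nonneg: "0 \<le> d x y"
    and refl [simp]: "x \<in> X \<Longrightarrow> d x x = 0"
    and sym: "x \<in> X \<Longrightarrow> y \<in> X \<Longrightarrow> d x y = d y x"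
    and triangle: "x \<in> X \<Longrightarrow> y \<in> X \<Longrightarrow> z \<in> X \<Longrightarrow> d x z \<le> d x y + d y z"
    and geodesic: "x \<in> X \<Longrightarrow> y \<in> X \<Longrightarrow>
      \<exists>(g :: nat \<Rightarrow> 'a) K. g 0 = x \<and> g K = y \<and> (\<forall>i\<le>K. g i \<in> X) \<and>
        (\<forall>i j. i \<le> j \<longrightarrow> j \<le> K \<longrightarrow> d (g i) (g j) = real (j - i))"
    and delta_pos: "0 < \<delta>"
    and four_point: "e \<in> X \<Longrightarrow> x \<in> X \<Longrightarrow> y \<in> X \<Longrightarrow> z \<in> X \<Longrightarrow>
      min ((d e x + d e y - d x y) / 2) ((d e y + d e z - d y z) / 2) - \<delta>
        \<le> (d e x + d e z - d x z) / 2"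
begin

definition gp :: "'a \<Rightarrow> 'a \<Rightarrow> 'a \<Rightarrow> real" where
  "gp e x y = (d e x + d e y - d x y) / 2"

lemma gp_min: "e \<in> X \<Longrightarrow> x \<in> X \<Longrightarrow> y \<in> X \<Longrightarrow> z \<in> X \<Longrightarrow> min (gp e x y) (gp e y z) - \<delta> \<le> gp e x z"
  using four_point unfolding gp_def .

lemma gp_sym: "x \<in> X \<Longrightarrow> y \<in> X \<Longrightarrow> gp e x y = gp e y x"
  by (simp add: gp_def sym)

lemma gp_three_steps:
  assumes X: "e \<in> X" "w \<in> X" "x \<in> X" "y \<in> X" "z \<in> X"
    and m: "m \<le> gp e w x" "m \<le> gp e x y" "m \<le> gp e y z"
  shows "m - 2 * \<delta> \<le> gp e w z"
  using gp_min[OF X(1,2,3,5)] gp_min[OF X(1,3,4,5)] m delta_pos by linarith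

definition geod :: "(nat \<Rightarrow> 'a) \<Rightarrow> nat \<Rightarrow> bool" where
  "geod g K \<longleftrightarrow> (\<forall>i\<le>K. g i \<in> X) \<and> (\<forall>i j. i \<le> j \<longrightarrow> j \<le> K \<longrightarrow> d (g i) (g j) = real (j - i))"

text \<open>Steps are bounded by \<open>l\<close>, so the upper inequality follows from the triangle
  inequality and only the lower one carries an additive constant.\<close>

definition quasigeod :: "real \<Rightarrow> real \<Rightarrow> (nat \<Rightarrow> 'a) \<Rightarrow> nat \<Rightarrow> bool" where
  "quasigeod l c q N \<longleftrightarrow> (\<forall>i\<le>N. q i \<in> X) \<and> (\<forall>i<N. d (q i) (q (Suc i)) \<le> l) \<and>
     (\<forall>i j. i \<le> j \<longrightarrow> j \<le> N \<longrightarrow> real (j - i) \<le> l * d (q i) (q j) + c)"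

text \<open>Halving the chain \<open>k\<close> times loses only \<open>k \<delta>\<close>, i.e. logarithmically in the length.\<close>

lemma gp_chain:
  assumes e: "e \<in> X" and "1 \<le> N" "N \<le> 2 ^ k"
    and "\<forall>i\<le>N. q i \<in> X" "\<forall>i<N. m \<le> gp e (q i) (q (Suc i))"
  shows "m - real k * \<delta> \<le> gp e (q 0) (q N)"
  using assms(2-)
proof (induction k arbitrary: q N)
  case 0
  then have "N = 1" by simp
  with 0 show ?case by simp
next
  case (Suc k)
  show ?case
  proof (cases "N \<le> 2 ^ k")
    case True
    from Suc.IH[OF Suc.prems(1) True Suc.prems(3,4)] delta_pos show ?thesis
      by (simp add: algebra_simps)
  next
    case False
    have 1: "m - real k * \<delta> \<le> gp e (q 0) (q (2 ^ k))"
      using Suc.prems False by (intro Suc.IH) auto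
    have "m - real k * \<delta> \<le> gp e (q (2 ^ k + 0)) (q (2 ^ k + (N - 2 ^ k)))"
      using Suc.prems False Suc.IH[of "N - 2 ^ k" "\<lambda>i. q (2 ^ k + i)"] by simp
    then have 2: "m - real k * \<delta> \<le> gp e (q (2 ^ k)) (q N)"
      using False by simp
    have "min (gp e (q 0) (q (2 ^ k))) (gp e (q (2 ^ k)) (q N)) - \<delta> \<le> gp e (q 0) (q N)"
      using Suc.prems False e by (intro gp_min) auto
    with 1 2 show ?thesis by (simp add: algebra_simps)
  qed
qed

lemma quasigeod_upper:
  assumes "quasigeod l c q N" "i \<le> j" "j \<le> N"
  shows "d (q i) (q j) \<le> l * real (j - i)"
  using assms(2,3)
proof (induction j rule: dec_induct)
  case base
  with assms(1) show ?case by (simp add: quasigeod_def)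
next
  case (step j)
  have "d (q i) (q (Suc j)) \<le> d (q i) (q j) + d (q j) (q (Suc j))"
    using assms(1) step by (intro triangle) (auto simp: quasigeod_def)
  also have "\<dots> \<le> l * real (j - i) + l"
    using assms(1) step by (intro add_mono) (auto simp: quasigeod_def)
  also have "\<dots> = l * real (Suc j - i)"
    using step by (simp add: Suc_diff_le algebra_simps)
  finally show ?case .
qed

text \<open>Consecutive vertices far from \<open>e\<close> and at most \<open>l\<close> apart have
  product at least \<open>D - l\<close>, and at most \<open>2 ^ k\<close> of them are chained
  between \<open>q i\<close> and \<open>q j\<close>. Both differences are bounded because the order
  of \<open>i\<close> and \<open>j\<close> is not known in the application.\<close>

lemma gp_quasigeod_far:
  assumes q: "quasigeod l c q N" and e: "e \<in> X" and far: "\<And>i. i \<le> N \<Longrightarrow> D \<le> d e (q i)"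
    and l: "1 \<le> l" and ij: "i \<le> N" "j \<le> N" and k: "real i - real j \<le> 2 ^ k" "real j - real i \<le> 2 ^ k"
  shows "D - l - real k * \<delta> \<le> gp e (q i) (q j)"
proof -
  have *: "D - l - real k * \<delta> \<le> gp e (q i) (q j)"
    if "i \<le> j" "j \<le> N" "real j - real i \<le> 2 ^ k" for i j
  proof (cases "i = j")
    case True
    have "D \<le> gp e (q i) (q j)"
      using q that far[of j] by (simp add: True gp_def quasigeod_def)
    moreover have "0 \<le> real k * \<delta>" using delta_pos by simp
    ultimately show ?thesis using l by linarith
  next
    case False
    have "real (j - i) \<le> real (2 ^ k)" using that by simp
    then have "j - i \<le> 2 ^ k" by (simp only: of_nat_le_iff)
    moreover have "D - l \<le> gp e (q (i + n)) (q (i + Suc n))" if "n < j - i" for n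
    proof -
      have "d (q (i + n)) (q (Suc (i + n))) \<le> l"
        using q that \<open>j \<le> N\<close> by (auto simp: quasigeod_def)
      moreover have "D \<le> d e (q (i + n))" "D \<le> d e (q (Suc (i + n)))"
        using that \<open>j \<le> N\<close> by (auto intro!: far)
      ultimately show ?thesis using l by (simp add: gp_def)
    qed
    moreover have "\<forall>n\<le>j - i. q (i + n) \<in> X"
      using q that by (auto simp: quasigeod_def)
    ultimately show ?thesis
      using gp_chain[OF e, of "j - i" k "\<lambda>n. q (i + n)" "D - l"] False that by simp
  qed
  show ?thesis
  proof (cases "i \<le> j")
    case True
    with * ij k show ?thesis by blast
  next
    case False
    then have "D - l - real k * \<delta> \<le> gp e (q j) (q i)"
      using * ij k by simp
    also have "\<dots> = gp e (q i) (q j)"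
      using q ij by (auto simp: quasigeod_def intro: gp_sym)
    finally show ?thesis .
  qed
qed

section \<open>The Morse lemma\<close>

lemma geod_near_quasigeod:
  assumes l: "1 \<le> l" and c: "0 \<le> c"
  obtains R where
    "\<And>g K q N a. geod g K \<Longrightarrow> quasigeod l c q N \<Longrightarrow> g 0 = q 0 \<Longrightarrow> g K = q N \<Longrightarrow> a \<le> K \<Longrightarrow>
       \<exists>i\<le>N. d (g a) (q i) \<le> R"
proof -
  \<comment> \<open>The maximal distance \<open>D\<close> below is bounded by a logarithm of a
    linear function of itself, and \<open>M\<close> resolves this. The \<open>6 * D + 2\<close> is
    twice the radius in \<open>near\<close>; the 3 counts the two losses in
    \<open>gp_three_steps\<close> and the rounding of the logarithm to \<open>k\<close>.\<close>
  obtain M where M: "\<And>D. D \<le> l + (log 2 (l * (6 * D + 2) + (c + 1)) + 3) * \<delta> \<Longrightarrow> D \<le> M"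
    using linear_le_log_bounded[of l \<delta> "c + 1"] l delta_pos by auto
  have "\<exists>i\<le>N. d (g a) (q i) \<le> M"
    if g: "geod g K" and q: "quasigeod l c q N" and ends: "g 0 = q 0" "g K = q N" and a: "a \<le> K"
    for g K q N a
  proof -
    have gX: "g i \<in> X" if "i \<le> K" for i using g that by (simp add: geod_def)
    have qX: "q i \<in> X" if "i \<le> N" for i using q that by (simp add: quasigeod_def)
    have gd: "d (g i) (g j) = real (j - i)" if "i \<le> j" "j \<le> K" for i j
      using g that by (simp add: geod_def)
    define f where "f b = Min ((\<lambda>i. d (g b) (q i)) ` {..N})" for b
    have f_le: "f b \<le> d (g b) (q i)" if "i \<le> N" for b i
      using that by (simp add: f_def)
    have f_ex: "\<exists>i\<le>N. d (g b) (q i) = f b" for b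
    proof -
      have "f b \<in> (\<lambda>i. d (g b) (q i)) ` {..N}" unfolding f_def by (intro Min_in) auto
      then show ?thesis by auto
    qed
    \<comment> \<open>At a point of the geodesic farthest from the quasigeodesic, walk \<open>2D\<close> in both directions: the
      quasigeodesic joins the two ends outside the \<open>D\<close>-ball with length linear in \<open>D\<close>.\<close>
    define D where "D = Max (f ` {..K})"
    have "D \<in> f ` {..K}" unfolding D_def by (intro Max_in) auto
    then obtain b where b: "b \<le> K" "f b = D" by auto
    have f_D: "f i \<le> D" if "i \<le> K" for i using that by (simp add: D_def)
    have D0: "0 \<le> D" using f_ex[of b] b nonneg by metis
    define T where "T = nat \<lceil>2 * D\<rceil>"
    have T: "2 * D \<le> real T" "real T \<le> 2 * D + 1" using D0 unfolding T_def by linarith+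
    let ?e = "g b" and ?u = "g (b - T)" and ?v = "g (min K (b + T))"
    have X: "?e \<in> X" "?u \<in> X" "?v \<in> X" using b by (auto intro!: gX)
    \<comment> \<open>Either \<open>w\<close> has distance \<open>T \<ge> 2 * D\<close> from
      \<open>?e\<close>, and the nearest \<open>q i\<close> is within \<open>D\<close> of
      \<open>w\<close>; or the walk stopped early at an end of the geodesic, and \<open>w\<close>
      lies on \<open>q\<close> itself.\<close>
    have near: "\<exists>i\<le>N. D \<le> gp ?e w (q i) \<and> d ?e (q i) \<le> 3 * D + 1"
      if w: "w = g r" "r \<le> K" "d ?e w = real T \<or> (d ?e w \<le> real T \<and> (\<exists>i\<le>N. w = q i))" for w r
    proof (cases "d ?e w = real T")
      case True
      obtain i where i: "i \<le> N" "d w (q i) = f r" using f_ex[of r] w by auto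
      have "d w (q i) \<le> D" using i f_D w by simp
      moreover have "D \<le> d ?e (q i)" using f_le[OF i(1), of b] b by simp
      moreover have "d ?e (q i) \<le> d ?e w + d w (q i)"
        using X gX w qX i by (intro triangle) auto
      ultimately show ?thesis using True T i(1) by (intro exI[of _ i]) (auto simp: gp_def)
    next
      case False
      then obtain i where i: "i \<le> N" "w = q i" "d ?e w \<le> real T" using w by auto
      have "D \<le> d ?e (q i)" using f_le[OF i(1), of b] b by simp
      then show ?thesis using i T D0 qX[OF i(1)] by (intro exI[of _ i]) (auto simp: gp_def)
    qed
    have eu: "d ?e ?u = real (b - (b - T))"
      using gd[of "b - T" b] b X sym by simp
    have ev: "d ?e ?v = real (min K (b + T) - b)"
      using gd[of b "min K (b + T)"] b by simp
    have uv: "d ?u ?v = real (min K (b + T) - (b - T))"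
      by (intro gd) (use b in auto)
    have "\<exists>i\<le>N. D \<le> gp ?e ?u (q i) \<and> d ?e (q i) \<le> 3 * D + 1"
    proof (rule near[OF HOL.refl])
      show "d ?e ?u = real T \<or> (d ?e ?u \<le> real T \<and> (\<exists>i\<le>N. ?u = q i))"
        using ends eu by (cases "T \<le> b") auto
    qed (use b in simp)
    then obtain i where i: "i \<le> N" "D \<le> gp ?e ?u (q i)" "d ?e (q i) \<le> 3 * D + 1" by auto
    have "\<exists>i\<le>N. D \<le> gp ?e ?v (q i) \<and> d ?e (q i) \<le> 3 * D + 1"
    proof (rule near[OF HOL.refl])
      show "d ?e ?v = real T \<or> (d ?e ?v \<le> real T \<and> (\<exists>i\<le>N. ?v = q i))"
        using ends ev by (cases "b + T \<le> K") (auto simp: min_def)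
    qed (use b in simp)
    then obtain j where j: "j \<le> N" "D \<le> gp ?e ?v (q j)" "d ?e (q j) \<le> 3 * D + 1" by auto
    have "d (q i) (q j) \<le> d (q i) ?e + d ?e (q j)"
      using X qX i j by (intro triangle) auto
    then have dij: "d (q i) (q j) \<le> 6 * D + 2"
      using sym[OF X(1) qX[OF i(1)]] i j by simp
    have dji: "d (q j) (q i) \<le> 6 * D + 2" using dij sym i j qX by metis
    let ?B = "l * (6 * D + 2) + (c + 1)"
    have B1: "1 \<le> ?B" using l c D0 by simp
    have lij: "real (j - i) \<le> ?B"
    proof (cases "i \<le> j")
      case True
      then have "real (j - i) \<le> l * d (q i) (q j) + c" using q j by (simp add: quasigeod_def)
      also have "\<dots> \<le> l * (6 * D + 2) + c" using dij l by simp
      finally show ?thesis by simp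
    qed (use B1 in simp)
    have lji: "real (i - j) \<le> ?B"
    proof (cases "j \<le> i")
      case True
      then have "real (i - j) \<le> l * d (q j) (q i) + c" using q i by (simp add: quasigeod_def)
      also have "\<dots> \<le> l * (6 * D + 2) + c" using dji l by simp
      finally show ?thesis by simp
    qed (use B1 in simp)
    define k where "k = nat \<lceil>log 2 ?B\<rceil>"
    have lB: "0 \<le> log 2 ?B" using B1 by simp
    then have k: "log 2 ?B \<le> real k" "real k \<le> log 2 ?B + 1" unfolding k_def by linarith+
    have "?B \<le> 2 powr real k" using k(1) B1 by (simp add: log_le_iff)
    then have B2: "?B \<le> 2 ^ k" by (simp add: powr_realpow)
    have far: "D - l - real k * \<delta> \<le> gp ?e (q i) (q j)"
      using q X(1) _ l i(1) j(1)
    proof (rule gp_quasigeod_far)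
      show "D \<le> d ?e (q n)" if "n \<le> N" for n using f_le[OF that, of b] b by simp
      show "real i - real j \<le> 2 ^ k" "real j - real i \<le> 2 ^ k" using lij lji B2 by linarith+
    qed
    have kd: "0 \<le> real k * \<delta>" using delta_pos by simp
    have 3: "gp ?e (q j) ?v = gp ?e ?v (q j)" using X qX j by (intro gp_sym) auto
    \<comment> \<open>\<open>?e\<close> lies on a geodesic from \<open>?u\<close> to
      \<open>?v\<close>, so this product vanishes, whereas the chain through \<open>q i\<close> and
      \<open>q j\<close> bounds it below by \<open>D - l - (k + 2) * \<delta>\<close>.\<close>
    have 4: "gp ?e ?u ?v = 0"
    proof -
      have "(b - (b - T)) + (min K (b + T) - b) = min K (b + T) - (b - T)" using b by auto
      then have "d ?e ?u + d ?e ?v = d ?u ?v" unfolding eu ev uv by (simp only: of_nat_add[symmetric])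
      then show ?thesis by (simp add: gp_def)
    qed
    have "D \<le> l + (real k + 2) * \<delta>"
      using gp_three_steps[OF X(1,2) qX[OF i(1)] qX[OF j(1)] X(3) _ far] 3 4 i(2) j(2) kd l
      by (simp add: distrib_right)
    also have "\<dots> \<le> l + ((log 2 ?B + 1) + 2) * \<delta>"
      using k delta_pos by simp
    finally have "D \<le> l + (log 2 ?B + 3) * \<delta>" by (simp add: algebra_simps)
    from M[OF this] f_D[OF a] f_ex[of a] show ?thesis by (metis order_trans)
  qed
  with that show ?thesis by blast
qed

text \<open>A discrete intermediate value argument: the geodesic is close to the part of
  \<open>q\<close> up to \<open>n\<close> at its start and to the part from \<open>n\<close> on at
  its end, so two of its vertices with indices differing by at most 1 are close to
  \<open>q i\<close> and \<open>q j\<close> with \<open>i \<le> n \<le> j\<close>. Then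
  \<open>j - i\<close> is bounded, and \<open>q n\<close> is near \<open>q i\<close>.\<close>

lemma quasigeod_near_geod:
  assumes l: "1 \<le> l" and c: "0 \<le> c"
  obtains R where
    "\<And>g K q N n. geod g K \<Longrightarrow> quasigeod l c q N \<Longrightarrow> g 0 = q 0 \<Longrightarrow> g K = q N \<Longrightarrow> n \<le> N \<Longrightarrow>
       \<exists>a\<le>K. d (q n) (g a) \<le> R"
proof -
  obtain D where D: "\<And>g K q N a. geod g K \<Longrightarrow> quasigeod l c q N \<Longrightarrow> g 0 = q 0 \<Longrightarrow> g K = q N \<Longrightarrow>
      a \<le> K \<Longrightarrow> \<exists>i\<le>N. d (g a) (q i) \<le> D"
    using geod_near_quasigeod[OF l c] by blast
  define R where "R = l * (l * (2 * D + 1) + c) + D"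
  have "\<exists>a\<le>K. d (q n) (g a) \<le> R"
    if g: "geod g K" and q: "quasigeod l c q N" and ends: "g 0 = q 0" "g K = q N" and n: "n \<le> N"
    for g K q N n
  proof -
    have gX: "g i \<in> X" if "i \<le> K" for i using g that by (simp add: geod_def)
    have qX: "q i \<in> X" if "i \<le> N" for i using q that by (simp add: quasigeod_def)
    have D0: "0 \<le> D" using D[OF g q ends, of 0] nonneg order_trans by blast
    define A where "A = {a. a \<le> K \<and> (\<exists>i\<le>n. d (g a) (q i) \<le> D)}"
    have "finite A" by (rule finite_subset[of _ "{..K}"]) (auto simp: A_def)
    moreover have "0 \<in> A" using D0 ends n qX[of 0] by (auto simp: A_def)
    ultimately have aA: "Max A \<in> A" and aM: "\<And>b. b \<in> A \<Longrightarrow> b \<le> Max A"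
      by (auto intro: Max_in)
    define a where "a = Max A"
    obtain i where i: "i \<le> n" "d (g a) (q i) \<le> D" and aK: "a \<le> K"
      using aA by (auto simp: A_def a_def)
    have "\<exists>b j. a \<le> b \<and> b \<le> a + 1 \<and> b \<le> K \<and> n \<le> j \<and> j \<le> N \<and> d (g b) (q j) \<le> D"
    proof (cases "a = K")
      case True
      then show ?thesis using ends n D0 qX[of N] by (intro exI[of _ a] exI[of _ N]) auto
    next
      case False
      then have "Suc a \<le> K" using aK by simp
      moreover obtain j where j: "j \<le> N" "d (g (Suc a)) (q j) \<le> D"
        using D[OF g q ends \<open>Suc a \<le> K\<close>] by blast
      moreover have "Suc a \<notin> A" using aM[of "Suc a"] a_def by auto
      ultimately have "n < j" by (auto simp: A_def not_le[symmetric])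
      then show ?thesis using j \<open>Suc a \<le> K\<close> by (intro exI[of _ "Suc a"] exI[of _ j]) auto
    qed
    then obtain b j where b: "a \<le> b" "b \<le> a + 1" "b \<le> K" and j: "n \<le> j" "j \<le> N" "d (g b) (q j) \<le> D"
      by blast
    have X: "g a \<in> X" "g b \<in> X" "q i \<in> X" "q j \<in> X" "q n \<in> X"
      using i j n aK b by (auto intro!: gX qX)
    have "d (g a) (g b) = real (b - a)" using g b by (simp add: geod_def)
    then have ab: "d (g a) (g b) \<le> 1" using b by simp
    have "d (q i) (q j) \<le> 2 * D + 1"
      using triangle[OF X(3,1,4)] triangle[OF X(1,2,4)] sym[OF X(3,1)] i(2) j(3) ab by linarith
    moreover have "real (j - i) \<le> l * d (q i) (q j) + c"
      using q i(1) j(1,2) by (simp add: quasigeod_def)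
    ultimately have "real (j - i) \<le> l * (2 * D + 1) + c"
      using l by (smt (verit) mult_left_mono)
    then have "real (n - i) \<le> l * (2 * D + 1) + c" using i j by linarith
    then have "l * real (n - i) \<le> l * (l * (2 * D + 1) + c)" using l by (intro mult_left_mono) auto
    then have "d (q i) (q n) \<le> l * (l * (2 * D + 1) + c)"
      using quasigeod_upper[OF q i(1) n] by linarith
    then have "d (q n) (g a) \<le> R"
      using triangle[OF X(5,3,1)] sym[OF X(3,5)] sym[OF X(3,1)] i(2) by (simp add: R_def)
    with aK show ?thesis by blast
  qed
  with that show ?thesis by blast
qed

text \<open>A geodesic with the same ends mediates: \<open>q n\<close> is near it, and each of its
  vertices is near \<open>p\<close>.\<close>

lemma Morse:
  assumes l: "1 \<le> l" and c: "0 \<le> c"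
  obtains R where
    "\<And>p M q N n. quasigeod l c p M \<Longrightarrow> quasigeod l c q N \<Longrightarrow> p 0 = q 0 \<Longrightarrow> p M = q N \<Longrightarrow> n \<le> N \<Longrightarrow>
       \<exists>i\<le>M. d (q n) (p i) \<le> R"
proof -
  obtain R1 where R1: "\<And>g K q N a. geod g K \<Longrightarrow> quasigeod l c q N \<Longrightarrow> g 0 = q 0 \<Longrightarrow> g K = q N \<Longrightarrow>
      a \<le> K \<Longrightarrow> \<exists>i\<le>N. d (g a) (q i) \<le> R1"
    using geod_near_quasigeod[OF l c] by blast
  obtain R2 where R2: "\<And>g K q N n. geod g K \<Longrightarrow> quasigeod l c q N \<Longrightarrow> g 0 = q 0 \<Longrightarrow> g K = q N \<Longrightarrow>
      n \<le> N \<Longrightarrow> \<exists>a\<le>K. d (q n) (g a) \<le> R2"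
    using quasigeod_near_geod[OF l c] by blast
  have "\<exists>i\<le>M. d (q n) (p i) \<le> R2 + R1"
    if p: "quasigeod l c p M" and q: "quasigeod l c q N" and ends: "p 0 = q 0" "p M = q N" and n: "n \<le> N"
    for p M q N n
  proof -
    have "q 0 \<in> X" "q N \<in> X" using q by (auto simp: quasigeod_def)
    from geodesic[OF this] obtain g K where g: "geod g K" and ge: "g 0 = q 0" "g K = q N"
      unfolding geod_def by blast
    obtain a where a: "a \<le> K" "d (q n) (g a) \<le> R2" using R2[OF g q ge n] by blast
    obtain i where i: "i \<le> M" "d (g a) (p i) \<le> R1" using R1[OF g p _ _ a(1)] ge ends by auto
    have "d (q n) (p i) \<le> d (q n) (g a) + d (g a) (p i)"
      using p q g a i n by (intro triangle) (auto simp: quasigeod_def geod_def)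
    with a i show ?thesis by (intro exI[of _ i]) auto
  qed
  with that show ?thesis by blast
qed

end

section \<open>Word metrics\<close>

locale word_metric = group G for G :: "('a, 'b) monoid_scheme" (structure) +
  fixes S :: "'a set"
  assumes gens: "symmetric_generating_set G S"
begin

abbreviation word :: "'a list \<Rightarrow> 'a" where
  "word w \<equiv> foldr (\<otimes>) w \<one>"

abbreviation len :: "'a \<Rightarrow> nat" where
  "len \<equiv> word_length G S"

abbreviation d :: "'a \<Rightarrow> 'a \<Rightarrow> real" where
  "d \<equiv> word_dist G S"

lemma finite_S: "finite S" and S_carrier: "S \<subseteq> carrier G" and inv_S: "s \<in> S \<Longrightarrow> inv s \<in> S"
  and generate_S: "generate G S = carrier G"
  using gens by (auto simp: symmetric_generating_set_def)

lemma mult_inv_cancel_left: "x \<in> carrier G \<Longrightarrow> y \<in> carrier G \<Longrightarrow> x \<otimes> (inv x \<otimes> y) = y"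
  and inv_mult_cancel_left: "x \<in> carrier G \<Longrightarrow> y \<in> carrier G \<Longrightarrow> inv x \<otimes> (x \<otimes> y) = y"
  by (simp_all add: m_assoc[symmetric])

lemma word_closed: "set w \<subseteq> carrier G \<Longrightarrow> word w \<in> carrier G"
  by (induction w) auto

lemma word_append: "set u \<subseteq> carrier G \<Longrightarrow> set v \<subseteq> carrier G \<Longrightarrow> word (u @ v) = word u \<otimes> word v"
  by (induction u) (auto simp: word_closed m_assoc)

lemma word_closed_S: "set w \<subseteq> S \<Longrightarrow> word w \<in> carrier G"
  using S_carrier by (intro word_closed) auto

lemma word_exists: "g \<in> carrier G \<Longrightarrow> \<exists>w. set w \<subseteq> S \<and> word w = g"
  unfolding generate_S[symmetric]
proof (induction rule: generate.induct)
  case one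
  show ?case by (intro exI[of _ "[]"]) auto
next
  case (incl h)
  then show ?case using S_carrier by (intro exI[of _ "[h]"]) auto
next
  case (inv h)
  then show ?case using S_carrier inv_S[of h] by (intro exI[of _ "[inv h]"]) auto
next
  case (eng h1 h2)
  then obtain u v where "set u \<subseteq> S" "word u = h1" "set v \<subseteq> S" "word v = h2" by auto
  moreover from this have "word (u @ v) = word u \<otimes> word v"
    using S_carrier by (intro word_append) auto
  ultimately show ?case by (intro exI[of _ "u @ v"]) auto
qed

lemma word_shortest:
  assumes "g \<in> carrier G"
  obtains w where "set w \<subseteq> S" "length w = len g" "word w = g"
proof -
  have "\<exists>n w. set w \<subseteq> S \<and> length w = n \<and> word w = g" using word_exists[OF assms] by auto
  from LeastI_ex[OF this] show ?thesis using that unfolding word_length_def by blast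
qed

lemma len_word_le: "set w \<subseteq> S \<Longrightarrow> len (word w) \<le> length w"
  unfolding word_length_def by (rule Least_le) auto

lemma len_one [simp]: "len \<one> = 0"
  using len_word_le[of "[]"] by simp

lemma len_generator: "s \<in> S \<Longrightarrow> len s \<le> 1"
  using len_word_le[of "[s]"] S_carrier by auto

lemma len_mult: "g \<in> carrier G \<Longrightarrow> h \<in> carrier G \<Longrightarrow> len (g \<otimes> h) \<le> len g + len h"
proof -
  assume g: "g \<in> carrier G" and h: "h \<in> carrier G"
  obtain u where u: "set u \<subseteq> S" "length u = len g" "word u = g" using word_shortest[OF g] .
  obtain v where v: "set v \<subseteq> S" "length v = len h" "word v = h" using word_shortest[OF h] .
  have "word (u @ v) = g \<otimes> h" using word_append[of u v] u v S_carrier by auto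
  with len_word_le[of "u @ v"] u v show ?thesis by simp
qed

lemma len_inv_le: "g \<in> carrier G \<Longrightarrow> len (inv g) \<le> len g"
proof -
  assume g: "g \<in> carrier G"
  have "len (inv (word w)) \<le> length w" if "set w \<subseteq> S" for w
    using that
  proof (induction w)
    case (Cons s w)
    then have s: "s \<in> S" "s \<in> carrier G" and w: "word w \<in> carrier G"
      using S_carrier word_closed_S by auto
    have "len (inv (word (s # w))) = len (inv (word w) \<otimes> inv s)"
      using s w by (simp add: inv_mult_group)
    also have "\<dots> \<le> len (inv (word w)) + len (inv s)" using s w by (intro len_mult) auto
    also have "\<dots> \<le> length w + 1" using Cons s len_generator[OF inv_S] by (intro add_mono) auto
    finally show ?case by simp
  qed simp
  with word_shortest[OF g] show ?thesis by metis
qed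

lemma len_inv: "g \<in> carrier G \<Longrightarrow> len (inv g) = len g"
  using len_inv_le[of g] len_inv_le[of "inv g"] by simp

lemma d_nonneg: "0 \<le> d x y"
  by (simp add: word_dist_def)

lemma d_refl [simp]: "x \<in> carrier G \<Longrightarrow> d x x = 0"
  by (simp add: word_dist_def)

lemma d_sym: "x \<in> carrier G \<Longrightarrow> y \<in> carrier G \<Longrightarrow> d x y = d y x"
  using len_inv[of "inv x \<otimes> y"] by (simp add: word_dist_def inv_mult_group)

lemma d_triangle:
  assumes "x \<in> carrier G" "y \<in> carrier G" "z \<in> carrier G"
  shows "d x z \<le> d x y + d y z"
proof -
  have "inv x \<otimes> z = (inv x \<otimes> y) \<otimes> (inv y \<otimes> z)" using assms by (simp add: m_assoc mult_inv_cancel_left)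
  then show ?thesis using len_mult[of "inv x \<otimes> y" "inv y \<otimes> z"] assms by (simp add: word_dist_def)
qed

lemma inv_mult_translate:
  "g \<in> carrier G \<Longrightarrow> x \<in> carrier G \<Longrightarrow> y \<in> carrier G \<Longrightarrow> inv (g \<otimes> x) \<otimes> (g \<otimes> y) = inv x \<otimes> y"
  by (simp add: inv_mult_group m_assoc inv_mult_cancel_left)

lemma d_translate:
  "g \<in> carrier G \<Longrightarrow> x \<in> carrier G \<Longrightarrow> y \<in> carrier G \<Longrightarrow> d (g \<otimes> x) (g \<otimes> y) = d x y"
  by (simp add: word_dist_def inv_mult_translate)

lemma d_mult_right: "x \<in> carrier G \<Longrightarrow> g \<in> carrier G \<Longrightarrow> d x (x \<otimes> g) = len g"
  by (simp add: word_dist_def m_assoc[symmetric])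

lemma geodesic_ex:
  assumes x: "x \<in> carrier G" and y: "y \<in> carrier G"
  shows "\<exists>(g :: nat \<Rightarrow> 'a) K. g 0 = x \<and> g K = y \<and> (\<forall>i\<le>K. g i \<in> carrier G) \<and>
    (\<forall>i j. i \<le> j \<longrightarrow> j \<le> K \<longrightarrow> d (g i) (g j) = real (j - i))"
proof -
  obtain w where w: "set w \<subseteq> S" "length w = len (inv x \<otimes> y)" "word w = inv x \<otimes> y"
    using word_shortest[of "inv x \<otimes> y"] x y by auto
  define g where "g i = x \<otimes> word (take i w)" for i
  have sub: "set (take i u) \<subseteq> S" "set (drop i u) \<subseteq> S" if "set u \<subseteq> S" for i u
    using that set_take_subset set_drop_subset by fastforce+
  have gc: "g i \<in> carrier G" for i
    using x sub w word_closed_S by (simp add: g_def)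
  have upper: "d (g i) (g j) \<le> real (j - i)" if "i \<le> j" "j \<le> length w" for i j
  proof -
    let ?v = "drop i (take j w)"
    have "take j w = take i w @ ?v"
      using that by (metis append_take_drop_id min.absorb1 take_take)
    moreover have "word (take i w @ ?v) = word (take i w) \<otimes> word ?v"
      using sub w S_carrier by (intro word_append) (meson order_trans)+
    ultimately have "g j = g i \<otimes> word ?v"
      using x sub w word_closed_S by (simp add: g_def m_assoc)
    then have "d (g i) (g j) = len (word ?v)"
      using gc sub w word_closed_S by (simp add: d_mult_right)
    also have "\<dots> \<le> length ?v" by (intro of_nat_mono len_word_le sub w(1))
    also have "\<dots> = j - i" using that by simp
    finally show ?thesis by simp
  qed
  have g0: "g 0 = x" using x by (simp add: g_def)
  have gK: "g (length w) = y" using x y w by (simp add: g_def m_assoc[symmetric])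
  have xy: "d x y = length w" using w by (simp add: word_dist_def)
  \<comment> \<open>A shortcut between two prefixes would join \<open>x\<close> to \<open>y\<close>
    by less than the length of a shortest word.\<close>
  have "d (g i) (g j) = real (j - i)" if ij: "i \<le> j" "j \<le> length w" for i j
  proof (rule antisym[OF upper[OF ij]])
    have "d x y \<le> d x (g i) + (d (g i) (g j) + d (g j) y)"
      using d_triangle[OF x gc y, of i] d_triangle[OF gc gc y, of i j] by linarith
    moreover have "d x (g i) \<le> i" using upper[of 0 i] ij g0 by simp
    moreover have "d (g j) y \<le> length w - j" using upper[of j "length w"] ij gK by simp
    ultimately show "real (j - i) \<le> d (g i) (g j)" using xy ij by simp
  qed
  with g0 gK gc show ?thesis by blast
qed

text \<open>The sum of the \<open>T\<close>-lengths of the elements of \<open>S\<close> is a crude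
  bound for their maximum. Used in both directions, this carries quasigeodesics from one generating
  set to another.\<close>

lemma len_compare:
  assumes "word_metric G T"
  obtains l where "1 \<le> l" "\<And>x y. x \<in> carrier G \<Longrightarrow> y \<in> carrier G \<Longrightarrow> word_dist G T x y \<le> l * d x y"
proof -
  interpret T: word_metric G T by fact
  define l where "l = 1 + (\<Sum>s\<in>S. T.len s)"
  have l: "T.len s \<le> l" if "s \<in> S" for s
    using member_le_sum[OF that _ finite_S, of T.len] by (simp add: l_def)
  have "T.len (word w) \<le> l * length w" if "set w \<subseteq> S" for w
    using that
  proof (induction w)
    case (Cons s w)
    then have s: "s \<in> S" "s \<in> carrier G" and w: "word w \<in> carrier G"
      using S_carrier word_closed_S by auto
    have "T.len (word (s # w)) \<le> T.len s + T.len (word w)" using T.len_mult[OF s(2) w] by simp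
    also have "\<dots> \<le> l + l * length w" using Cons l[OF s(1)] by (intro add_mono) auto
    finally show ?case by simp
  qed simp
  then have "T.len g \<le> l * len g" if "g \<in> carrier G" for g
    using word_shortest[OF that] by metis
  then have "real (T.len g) \<le> real l * real (len g)" if "g \<in> carrier G" for g
    using that by (metis of_nat_le_iff of_nat_mult)
  then show ?thesis
    by (intro that[of "real l"]) (simp_all add: word_dist_def l_def sum_nonneg)
qed

lemma lipschitz_on_generators:
  fixes \<phi> :: "'a \<Rightarrow> real"
  assumes step: "\<And>x s. x \<in> carrier G \<Longrightarrow> s \<in> S \<Longrightarrow> \<bar>\<phi> (x \<otimes> s) - \<phi> x\<bar> \<le> L"
    and x: "x \<in> carrier G" and y: "y \<in> carrier G"
  shows "\<bar>\<phi> x - \<phi> y\<bar> \<le> L * d x y"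
proof -
  have "\<bar>\<phi> (x \<otimes> word w) - \<phi> x\<bar> \<le> L * length w" if "set w \<subseteq> S" "x \<in> carrier G" for w x
    using that
  proof (induction w arbitrary: x)
    case (Cons s w)
    then have s: "s \<in> S" "s \<in> carrier G" and w: "word w \<in> carrier G"
      using S_carrier word_closed_S by auto
    have "x \<otimes> word (s # w) = (x \<otimes> s) \<otimes> word w" using s w Cons by (simp add: m_assoc)
    moreover have "\<bar>\<phi> ((x \<otimes> s) \<otimes> word w) - \<phi> (x \<otimes> s)\<bar> \<le> L * length w"
      using Cons s by auto
    moreover have "\<bar>\<phi> (x \<otimes> s) - \<phi> x\<bar> \<le> L" using step Cons s by simp
    ultimately show ?case by (simp add: algebra_simps)
  qed simp
  moreover obtain w where "set w \<subseteq> S" "length w = len (inv x \<otimes> y)" "word w = inv x \<otimes> y"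
    using word_shortest[of "inv x \<otimes> y"] x y by auto
  moreover have "x \<otimes> (inv x \<otimes> y) = y" using x y by (simp add: m_assoc[symmetric])
  ultimately show ?thesis using x by (metis abs_minus_commute word_dist_def)
qed

lemma finite_ball: "finite {g \<in> carrier G. real (len g) \<le> C}"
proof (rule finite_subset)
  show "{g \<in> carrier G. real (len g) \<le> C} \<subseteq> word ` {w. set w \<subseteq> S \<and> length w \<le> nat \<lfloor>C\<rfloor>}"
  proof
    fix g assume g: "g \<in> {g \<in> carrier G. real (len g) \<le> C}"
    then obtain w where "set w \<subseteq> S" "length w = len g" "word w = g" using word_shortest[of g] by auto
    with g show "g \<in> word ` {w. set w \<subseteq> S \<and> length w \<le> nat \<lfloor>C\<rfloor>}"
      by (intro image_eqI[of _ _ w]) (auto simp: le_nat_floor)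
  qed
  show "finite (word ` {w. set w \<subseteq> S \<and> length w \<le> nat \<lfloor>C\<rfloor>})"
    using finite_lists_length_le[OF finite_S] by auto
qed

end

text \<open>The added 1 makes the constant strictly positive, which
  \<open>linear_le_log_bounded\<close> asks of its coefficient \<open>b\<close>.\<close>

lemma word_dist_hyperbolic_metric:
  assumes "word_metric G T" "0 \<le> \<delta>"
    and "\<forall>e\<in>carrier G. \<forall>x\<in>carrier G. \<forall>y\<in>carrier G. \<forall>z\<in>carrier G.
      gromov_product G T e x z \<ge> min (gromov_product G T e x y) (gromov_product G T e y z) - \<delta>"
  shows "hyperbolic_metric (carrier G) (word_dist G T) (\<delta> + 1)"
proof -
  interpret T: word_metric G T by fact
  have "min ((T.d e x + T.d e y - T.d x y) / 2) ((T.d e y + T.d e z - T.d y z) / 2) - (\<delta> + 1)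
        \<le> (T.d e x + T.d e z - T.d x z) / 2"
    if "e \<in> carrier G" "x \<in> carrier G" "y \<in> carrier G" "z \<in> carrier G" for e x y z
  proof -
    have "gromov_product G T e x z \<ge> min (gromov_product G T e x y) (gromov_product G T e y z) - \<delta>"
      using assms(3) that by blast
    then show ?thesis unfolding gromov_product_def by linarith
  qed
  then show ?thesis
    using assms(2) T.d_nonneg T.d_refl T.d_sym T.d_triangle T.geodesic_ex
    by unfold_locales auto
qed

section \<open>Stability for an arbitrary word metric of a hyperbolic group\<close>

locale hyperbolic_word_metric = word_metric +
  assumes hyperbolic: "hyperbolic_group G"
begin

text \<open>
  The word metric of \<open>S\<close> is not itself assumed to be hyperbolic: an \<open>S\<close>-geodesic is a
  quasigeodesic for the generating set witnessing hyperbolicity, and the Morse lemma is applied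
  to it and to the given path there.
\<close>

lemma quasigeodesic_stability:
  assumes l: "1 \<le> l" and c: "0 \<le> c"
  obtains R where
    "\<And>p N n. (\<And>i. i \<le> N \<Longrightarrow> p i \<in> carrier G) \<Longrightarrow> (\<And>i. i < N \<Longrightarrow> d (p i) (p (Suc i)) \<le> l) \<Longrightarrow>
       (\<And>i j. i \<le> j \<Longrightarrow> j \<le> N \<Longrightarrow> real (j - i) \<le> l * d (p i) (p j) + c) \<Longrightarrow> n \<le> N \<Longrightarrow>
       d (p 0) (p n) + d (p n) (p N) \<le> d (p 0) (p N) + R"
proof -
  from hyperbolic obtain T \<delta> where T: "symmetric_generating_set G T" "0 \<le> \<delta>"
    "\<forall>e\<in>carrier G. \<forall>x\<in>carrier G. \<forall>y\<in>carrier G. \<forall>z\<in>carrier G.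
      gromov_product G T e x z \<ge> min (gromov_product G T e x y) (gromov_product G T e y z) - \<delta>"
    unfolding hyperbolic_group_def by blast
  interpret T: word_metric G T using T(1) by unfold_locales
  interpret H: hyperbolic_metric "carrier G" T.d "\<delta> + 1"
    using word_dist_hyperbolic_metric[OF T.word_metric_axioms T(2,3)] .
  obtain a where a: "1 \<le> a" "\<And>x y. x \<in> carrier G \<Longrightarrow> y \<in> carrier G \<Longrightarrow> T.d x y \<le> a * d x y"
    using len_compare[OF T.word_metric_axioms] by blast
  obtain b where b: "1 \<le> b" "\<And>x y. x \<in> carrier G \<Longrightarrow> y \<in> carrier G \<Longrightarrow> d x y \<le> b * T.d x y"
    using T.len_compare[OF word_metric_axioms] by blast
  \<comment> \<open>In the metric of \<open>T\<close> a step may be longer by a factor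
    \<open>a\<close>, and the lower inequality loses a factor \<open>b\<close>; all factors are at
    least 1, so the product covers both.\<close>
  define m where "m = a * b * l"
  have al: "a * l \<le> m" using mult_left_mono[OF b(1), of "a * l"] a(1) l by (simp add: m_def mult_ac)
  have bl: "b * l \<le> m" using mult_left_mono[OF a(1), of "b * l"] b(1) l by (simp add: m_def mult_ac)
  have "a * 1 \<le> a * l" using l a(1) by (intro mult_left_mono) auto
  then have am: "a \<le> m" and m1: "1 \<le> m" using al a(1) by linarith+
  have quasi: "H.quasigeod m c p N"
    if p: "\<And>i. i \<le> N \<Longrightarrow> p i \<in> carrier G" and step: "\<And>i. i < N \<Longrightarrow> d (p i) (p (Suc i)) \<le> l"
      and lower: "\<And>i j. i \<le> j \<Longrightarrow> j \<le> N \<Longrightarrow> real (j - i) \<le> l * d (p i) (p j) + c" for p N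
    unfolding H.quasigeod_def
  proof (intro conjI allI impI)
    fix i assume "i < N"
    then have "T.d (p i) (p (Suc i)) \<le> a * d (p i) (p (Suc i))" using p by (intro a) auto
    also have "\<dots> \<le> a * l" using step[OF \<open>i < N\<close>] a(1) by simp
    finally show "T.d (p i) (p (Suc i)) \<le> m" using al by simp
  next
    fix i j assume ij: "i \<le> j" "j \<le> N"
    have "l * d (p i) (p j) \<le> l * (b * T.d (p i) (p j))"
      using ij p l by (intro mult_left_mono b) auto
    also have "\<dots> = (b * l) * T.d (p i) (p j)" by (simp add: mult_ac)
    also have "\<dots> \<le> m * T.d (p i) (p j)" using bl T.d_nonneg by (intro mult_right_mono)
    finally show "real (j - i) \<le> m * T.d (p i) (p j) + c" using lower[OF ij] by simp
  qed (use p in blast)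
  obtain R where R: "\<And>p M q N n. H.quasigeod m c p M \<Longrightarrow> H.quasigeod m c q N \<Longrightarrow> p 0 = q 0 \<Longrightarrow>
      p M = q N \<Longrightarrow> n \<le> N \<Longrightarrow> \<exists>i\<le>M. T.d (q n) (p i) \<le> R"
    using H.Morse[OF m1 c] by blast
  \<comment> \<open>Some vertex of an \<open>S\<close>-geodesic is within \<open>b * R\<close> of
    \<open>p n\<close>, so the detour costs at most twice that.\<close>
  have "d (p 0) (p n) + d (p n) (p N) \<le> d (p 0) (p N) + 2 * (b * R)"
    if p: "\<And>i. i \<le> N \<Longrightarrow> p i \<in> carrier G" and step: "\<And>i. i < N \<Longrightarrow> d (p i) (p (Suc i)) \<le> l"
      and lower: "\<And>i j. i \<le> j \<Longrightarrow> j \<le> N \<Longrightarrow> real (j - i) \<le> l * d (p i) (p j) + c"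
      and n: "n \<le> N" for p N n
  proof -
    obtain g K where g: "g 0 = p 0" "g K = p N" "\<And>i. i \<le> K \<Longrightarrow> g i \<in> carrier G"
      "\<And>i j. i \<le> j \<Longrightarrow> j \<le> K \<Longrightarrow> d (g i) (g j) = real (j - i)"
      using geodesic_ex[OF p p, of 0 N] by auto
    have "H.quasigeod m c g K"
    proof (rule quasi)
      fix i j assume "i \<le> j" "j \<le> K"
      then have "real (j - i) = d (g i) (g j)" using g(4) by simp
      also have "\<dots> \<le> l * d (g i) (g j)" using mult_right_mono[OF l d_nonneg] by simp
      finally show "real (j - i) \<le> l * d (g i) (g j) + c" using c by simp
    qed (use g l in auto)
    from R[OF this quasi[OF p step lower] g(1,2) n]
    obtain i where i: "i \<le> K" "T.d (p n) (g i) \<le> R" by blast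
    have "d (p n) (g i) \<le> b * T.d (p n) (g i)" using p g i n by (intro b) auto
    also have "\<dots> \<le> b * R" using i b(1) by simp
    finally have ng: "d (p n) (g i) \<le> b * R" .
    have X: "p n \<in> carrier G" "g i \<in> carrier G" "p 0 \<in> carrier G" "p N \<in> carrier G"
      using p g i n by auto
    have "d (p 0) (g i) = real i" "d (g i) (p N) = real (K - i)" "d (p 0) (p N) = real K"
      using g(4)[of 0 i] g(4)[of i K] g(4)[of 0 K] g(1,2) i by auto
    then show ?thesis
      using d_triangle[OF X(3,2,1)] d_triangle[OF X(1,2,4)] d_sym[OF X(1,2)] ng i(1) by simp
  qed
  with that show ?thesis by blast
qed

end

section \<open>Boundary points\<close>

lemma filterlim_prod_sequentially_at_top_iff:
  fixes F :: "nat \<Rightarrow> nat \<Rightarrow> real"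
  shows "filterlim (\<lambda>(i, j). F i j) at_top (sequentially \<times>\<^sub>F sequentially) \<longleftrightarrow>
    (\<forall>r. \<exists>N. \<forall>i\<ge>N. \<forall>j\<ge>N. r \<le> F i j)"
  unfolding filterlim_at_top eventually_prod_sequentially by auto blast+

context word_metric
begin

definition gp_unbounded :: "(nat \<Rightarrow> 'a) \<Rightarrow> (nat \<Rightarrow> 'a) \<Rightarrow> bool" where
  "gp_unbounded x y \<longleftrightarrow> (\<forall>r. \<exists>N. \<forall>i\<ge>N. \<forall>j\<ge>N. r \<le> gromov_product G S \<one> (x i) (y j))"

text \<open>The boundary point of \<open>x\<close> if \<open>x\<close> converges at infinity, and
  the empty set otherwise; so the equations for shifts and translates only ask that \<open>x\<close>
  lies in the group.\<close>

abbreviation endpoint :: "(nat \<Rightarrow> 'a) \<Rightarrow> (nat \<Rightarrow> 'a) set" where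
  "endpoint x \<equiv> boundary_rel G S `` {x}"

lemma converging_iff: "converging_at_infinity G S x \<longleftrightarrow> range x \<subseteq> carrier G \<and> gp_unbounded x x"
  by (simp add: converging_at_infinity_def filterlim_prod_sequentially_at_top_iff gp_unbounded_def)

lemma boundary_rel_iff:
  "(x, y) \<in> boundary_rel G S \<longleftrightarrow>
     converging_at_infinity G S x \<and> converging_at_infinity G S y \<and> gp_unbounded x y"
  by (simp add: boundary_rel_def filterlim_prod_sequentially_at_top_iff gp_unbounded_def)

lemma endpoint_self: "converging_at_infinity G S x \<Longrightarrow> x \<in> endpoint x"
  by (simp add: boundary_rel_iff converging_iff)

lemma endpoint_in_boundary: "converging_at_infinity G S x \<Longrightarrow> endpoint x \<in> gromov_boundary G S"
  unfolding gromov_boundary_def by (rule quotientI) simp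

lemma gp_unbounded_shift:
  "gp_unbounded (\<lambda>i. x (n + i)) y \<longleftrightarrow> gp_unbounded x y"
  "gp_unbounded x (\<lambda>i. y (n + i)) \<longleftrightarrow> gp_unbounded x y"
proof -
  have shift: "(\<exists>N. \<forall>i\<ge>N. \<forall>j\<ge>N. P (n + i) j) \<longleftrightarrow> (\<exists>N. \<forall>i\<ge>N. \<forall>j\<ge>N. P i j)" for P :: "nat \<Rightarrow> nat \<Rightarrow> bool"
  proof
    assume "\<exists>N. \<forall>i\<ge>N. \<forall>j\<ge>N. P (n + i) j"
    then obtain N where N: "\<And>i j. i \<ge> N \<Longrightarrow> j \<ge> N \<Longrightarrow> P (n + i) j" by blast
    have "P i j" if "i \<ge> n + N" "j \<ge> n + N" for i j
      using N[of "i - n" j] that by simp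
    then show "\<exists>N. \<forall>i\<ge>N. \<forall>j\<ge>N. P i j" by blast
  next
    assume "\<exists>N. \<forall>i\<ge>N. \<forall>j\<ge>N. P i j"
    then show "\<exists>N. \<forall>i\<ge>N. \<forall>j\<ge>N. P (n + i) j" by (meson trans_le_add2)
  qed
  show "gp_unbounded (\<lambda>i. x (n + i)) y \<longleftrightarrow> gp_unbounded x y"
    unfolding gp_unbounded_def shift[of "\<lambda>i j. _ \<le> gromov_product G S \<one> (x i) (y j)"] ..
  have "(\<exists>N. \<forall>i\<ge>N. \<forall>j\<ge>N. P i (n + j)) \<longleftrightarrow> (\<exists>N. \<forall>i\<ge>N. \<forall>j\<ge>N. P i j)" for P :: "nat \<Rightarrow> nat \<Rightarrow> bool"
    using shift[of "\<lambda>i j. P j i"] by blast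
  from this[of "\<lambda>i j. _ \<le> gromov_product G S \<one> (x i) (y j)"]
  show "gp_unbounded x (\<lambda>i. y (n + i)) \<longleftrightarrow> gp_unbounded x y"
    unfolding gp_unbounded_def by simp
qed

lemma endpoint_shift:
  assumes "range x \<subseteq> carrier G"
  shows "endpoint (\<lambda>i. x (n + i)) = endpoint x"
proof -
  have "converging_at_infinity G S (\<lambda>i. x (n + i)) \<longleftrightarrow> converging_at_infinity G S x"
    using assms by (auto simp: converging_iff gp_unbounded_shift)
  then show ?thesis by (auto simp: boundary_rel_iff gp_unbounded_shift)
qed

lemma gromov_product_change_base:
  assumes "e \<in> carrier G" "f \<in> carrier G" "x \<in> carrier G" "y \<in> carrier G"
  shows "gromov_product G S f x y - d e f \<le> gromov_product G S e x y"
  using d_triangle[of f e x] d_triangle[of f e y] d_sym[of e f] assms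
  unfolding gromov_product_def by argo

text \<open>Translation is an isometry that moves the base point to \<open>g\<close>; moving it back
  costs \<open>d \<one> g\<close>.\<close>

lemma gromov_product_translate:
  assumes "g \<in> carrier G" "x \<in> carrier G" "y \<in> carrier G"
  shows "gromov_product G S \<one> x y - d \<one> g \<le> gromov_product G S \<one> (g \<otimes> x) (g \<otimes> y)"
proof -
  have "gromov_product G S \<one> x y = gromov_product G S g (g \<otimes> x) (g \<otimes> y)"
    using d_translate[of g \<one> x] d_translate[of g \<one> y] d_translate[of g x y] assms
    by (simp add: gromov_product_def)
  with gromov_product_change_base[of \<one> g "g \<otimes> x" "g \<otimes> y"] assms show ?thesis by simp
qed

lemma gp_unbounded_translate:
  assumes g: "g \<in> carrier G" and x: "range x \<subseteq> carrier G" and y: "range y \<subseteq> carrier G"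
    and xy: "gp_unbounded x y"
  shows "gp_unbounded (\<lambda>i. g \<otimes> x i) (\<lambda>i. g \<otimes> y i)"
  unfolding gp_unbounded_def
proof
  fix r
  obtain N where "\<forall>i\<ge>N. \<forall>j\<ge>N. r + d \<one> g \<le> gromov_product G S \<one> (x i) (y j)"
    using xy unfolding gp_unbounded_def by blast
  moreover have "gromov_product G S \<one> (x i) (y j) - d \<one> g
      \<le> gromov_product G S \<one> (g \<otimes> x i) (g \<otimes> y j)" for i j
    using g x y by (intro gromov_product_translate) auto
  ultimately have "\<forall>i\<ge>N. \<forall>j\<ge>N. r \<le> gromov_product G S \<one> (g \<otimes> x i) (g \<otimes> y j)"
    by (smt (verit))
  then show "\<exists>N. \<forall>i\<ge>N. \<forall>j\<ge>N. r \<le> gromov_product G S \<one> (g \<otimes> x i) (g \<otimes> y j)" ..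
qed

lemma boundary_rel_translate:
  assumes "g \<in> carrier G" "(x, y) \<in> boundary_rel G S"
  shows "((\<lambda>i. g \<otimes> x i), (\<lambda>i. g \<otimes> y i)) \<in> boundary_rel G S"
  using assms gp_unbounded_translate[of g] unfolding boundary_rel_iff converging_iff by auto

lemma boundary_act_endpoint:
  assumes g: "g \<in> carrier G" and x: "range x \<subseteq> carrier G"
  shows "boundary_act G g (endpoint x) = endpoint (\<lambda>i. g \<otimes> x i)"
proof
  show "boundary_act G g (endpoint x) \<subseteq> endpoint (\<lambda>i. g \<otimes> x i)"
    using boundary_rel_translate[OF g] by (auto simp: boundary_act_def)
  show "endpoint (\<lambda>i. g \<otimes> x i) \<subseteq> boundary_act G g (endpoint x)"
  proof
    fix z assume "z \<in> endpoint (\<lambda>i. g \<otimes> x i)"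
    then have z: "((\<lambda>i. g \<otimes> x i), z) \<in> boundary_rel G S" by simp
    then have zc: "z i \<in> carrier G" for i by (auto simp: boundary_rel_iff converging_iff)
    have "((\<lambda>i. inv g \<otimes> (g \<otimes> x i)), (\<lambda>i. inv g \<otimes> z i)) \<in> boundary_rel G S"
      using boundary_rel_translate[OF _ z, of "inv g"] g by simp
    moreover have "(\<lambda>i. inv g \<otimes> (g \<otimes> x i)) = x"
      using g x by (simp add: inv_mult_cancel_left range_subsetD)
    moreover have "z = (\<lambda>i. g \<otimes> (inv g \<otimes> z i))"
      using g zc by (auto simp: mult_inv_cancel_left)
    ultimately show "z \<in> boundary_act G g (endpoint x)"
      unfolding boundary_act_def by (intro image_eqI[of _ _ "\<lambda>i. inv g \<otimes> z i"]) auto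
  qed
qed

text \<open>A neighbourhood asks for one good pair of representatives, so an estimate for the given
  sequences suffices.\<close>

lemma endpoint_in_nbhd:
  assumes "converging_at_infinity G S x" "converging_at_infinity G S y"
    and "\<And>i j. i \<ge> N \<Longrightarrow> j \<ge> N \<Longrightarrow> r \<le> gromov_product G S \<one> (x i) (y j)"
  shows "endpoint y \<in> boundary_nbhd G S (endpoint x) r"
proof -
  have "ereal r \<le> Liminf (sequentially \<times>\<^sub>F sequentially)
          (\<lambda>(i, j). ereal (gromov_product G S \<one> (x i) (y j)))"
    using assms(3) by (intro Liminf_bounded) (auto simp: eventually_prod_sequentially)
  then show ?thesis
    unfolding boundary_nbhd_def
    using assms(1,2) endpoint_self endpoint_in_boundary by blast
qed

end

section \<open>Endpoints of rays\<close>

text \<open>An interface to be instantiated by the action and by its opposite. The height is scaled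
  to be 1-Lipschitz, so that \<open>c\<close> is also a lower bound for the speed of a ray in the
  word metric.\<close>

locale hyperbolic_up_steps = hyperbolic_word_metric G S for G :: "('a, 'b) monoid_scheme" (structure) and S +
  fixes E :: "'a \<Rightarrow> 'a \<Rightarrow> bool" and C c :: real and \<phi> :: "'a \<Rightarrow> real"
  assumes C: "1 \<le> C" and c: "0 < c"
    and E_carrier: "E x y \<Longrightarrow> x \<in> carrier G \<and> y \<in> carrier G"
    and E_dist: "E x y \<Longrightarrow> d x y \<le> C"
    and E_translate: "g \<in> carrier G \<Longrightarrow> E x y \<Longrightarrow> E (g \<otimes> x) (g \<otimes> y)"
    and E_height: "E x y \<Longrightarrow> \<phi> x + c \<le> \<phi> y"
    and height_lipschitz: "x \<in> carrier G \<Longrightarrow> y \<in> carrier G \<Longrightarrow> \<bar>\<phi> x - \<phi> y\<bar> \<le> d x y"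
    and E_serial: "x \<in> carrier G \<Longrightarrow> \<exists>y. E x y"
    and E_confluent: "x \<in> carrier G \<Longrightarrow> y \<in> carrier G \<Longrightarrow> d x y \<le> 2 * C \<Longrightarrow> \<exists>z. E\<^sup>*\<^sup>* x z \<and> E\<^sup>*\<^sup>* y z"
begin

definition ray :: "(nat \<Rightarrow> 'a) \<Rightarrow> bool" where
  "ray x \<longleftrightarrow> (\<forall>i. E (x i) (x (Suc i)))"

definition ray_ends :: "(nat \<Rightarrow> 'a) set set" where
  "ray_ends = endpoint ` Collect ray"

lemma ray_step: "ray x \<Longrightarrow> E (x i) (x (Suc i))"
  by (simp add: ray_def)

lemma ray_carrier: "ray x \<Longrightarrow> x i \<in> carrier G"
  using E_carrier ray_step by blast

lemma ray_range: "ray x \<Longrightarrow> range x \<subseteq> carrier G"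
  using ray_carrier by blast

lemma ray_tl: "ray x \<Longrightarrow> ray (\<lambda>i. x (Suc i))"
  by (simp add: ray_def)

lemma endpoint_ray_shift: "ray x \<Longrightarrow> endpoint (\<lambda>i. x (n + i)) = endpoint x"
  by (intro endpoint_shift ray_range)

lemma endpoint_ray_tl: "ray x \<Longrightarrow> endpoint (\<lambda>i. x (Suc i)) = endpoint x"
  using endpoint_ray_shift[of x 1] by simp

lemma ray_exists:
  assumes "g \<in> carrier G"
  obtains x where "ray x" "x 0 = g"
proof -
  obtain f where f: "\<And>x. x \<in> carrier G \<Longrightarrow> E x (f x)" using E_serial by metis
  have "(f ^^ i) g \<in> carrier G" for i
    using assms f E_carrier by (induction i) auto
  then have "ray (\<lambda>i. (f ^^ i) g)" using f by (simp add: ray_def)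
  with that[of "\<lambda>i. (f ^^ i) g"] show ?thesis by simp
qed

lemma ray_translate: "g \<in> carrier G \<Longrightarrow> ray x \<Longrightarrow> ray (\<lambda>i. g \<otimes> x i)"
  by (simp add: ray_def E_translate)

text \<open>This turns confluence of finite paths into confluence at infinity: two paths to
  \<open>z\<close> are continued by the same ray.\<close>

lemma ray_prepend:
  assumes "E\<^sup>*\<^sup>* g z" "ray r" "r 0 = z"
  obtains x where "ray x" "x 0 = g" "endpoint x = endpoint r"
proof -
  have "\<exists>x. ray x \<and> x 0 = g \<and> endpoint x = endpoint r"
    using assms
  proof (induction rule: converse_rtranclp_induct)
    case (step g h)
    then obtain x where x: "ray x" "x 0 = h" "endpoint x = endpoint r" by auto
    let ?y = "case_nat g x"
    have "ray ?y" using x step.hyps(1) by (auto simp: ray_def split: nat.split)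
    moreover from this have "endpoint ?y = endpoint x" using endpoint_ray_tl[of ?y] by simp
    ultimately show ?case using x by (intro exI[of _ ?y]) auto
  qed auto
  with that show ?thesis by blast
qed

lemma ray_height:
  assumes "ray x" "i \<le> j"
  shows "\<phi> (x i) + c * real (j - i) \<le> \<phi> (x j)"
  using assms(2)
proof (induction j rule: dec_induct)
  case (step j)
  with E_height[OF ray_step[OF assms(1), of j]] show ?case by (simp add: Suc_diff_le algebra_simps)
qed simp

lemma ray_dist_ge:
  assumes "ray x" "i \<le> j"
  shows "c * real (j - i) \<le> d (x i) (x j)"
  using ray_height[OF assms] height_lipschitz[OF ray_carrier ray_carrier, of x x i j] assms(1) by linarith

lemma ray_stability:
  obtains R where "\<And>x n m. ray x \<Longrightarrow> n \<le> m \<Longrightarrow> d (x 0) (x n) + d (x n) (x m) \<le> d (x 0) (x m) + R"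
proof -
  \<comment> \<open>\<open>C\<close> bounds the steps and \<open>1 / c\<close> is the inverse of the
    minimal speed. Neither depends on the ray, so one \<open>R\<close> serves for all rays.\<close>
  define l where "l = max C (1 / c)"
  have l: "1 \<le> l" "C \<le> l" using C by (auto simp: l_def)
  have "1 / c * c \<le> l * c" using c by (intro mult_right_mono) (auto simp: l_def)
  then have lc: "1 \<le> l * c" using c by simp
  obtain R where R: "\<And>p N n. (\<And>i. i \<le> N \<Longrightarrow> p i \<in> carrier G) \<Longrightarrow>
      (\<And>i. i < N \<Longrightarrow> d (p i) (p (Suc i)) \<le> l) \<Longrightarrow>
      (\<And>i j. i \<le> j \<Longrightarrow> j \<le> N \<Longrightarrow> real (j - i) \<le> l * d (p i) (p j) + 0) \<Longrightarrow> n \<le> N \<Longrightarrow>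
       d (p 0) (p n) + d (p n) (p N) \<le> d (p 0) (p N) + R"
    using quasigeodesic_stability[OF l(1) order_refl] by blast
  have "d (x 0) (x n) + d (x n) (x m) \<le> d (x 0) (x m) + R" if x: "ray x" and "n \<le> m" for x n m
  proof (rule R)
    fix i j :: nat assume "i \<le> j"
    have "1 * real (j - i) \<le> (l * c) * real (j - i)" using lc by (intro mult_right_mono) auto
    also have "\<dots> \<le> l * d (x i) (x j)"
      using ray_dist_ge[OF x \<open>i \<le> j\<close>] l by simp
    finally show "real (j - i) \<le> l * d (x i) (x j) + 0" by simp
  next
    fix i show "d (x i) (x (Suc i)) \<le> l" using E_dist[OF ray_step[OF x]] l(2) by (rule order_trans)
  qed (use that ray_carrier in auto)
  with that show ?thesis by blast
qed

text \<open>By stability both rays pass their common vertex \<open>x n\<close> at bounded cost, so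
  seen from \<open>x 0\<close> the product is at least \<open>d (x 0) (x n) - R\<close>; the last
  term is the change of base point. Only the \<open>n\<close>-th vertices have to agree, not those
  before. With \<open>x = y\<close> this gives convergence, with \<open>x \<noteq> y\<close>
  continuity of the path.\<close>

lemma ray_gromov_product:
  obtains R where "\<And>x y n i j. ray x \<Longrightarrow> ray y \<Longrightarrow> x 0 = y 0 \<Longrightarrow> x n = y n \<Longrightarrow> n \<le> i \<Longrightarrow> n \<le> j \<Longrightarrow>
    c * real n - R - d \<one> (x 0) \<le> gromov_product G S \<one> (x i) (y j)"
proof -
  obtain R where R: "\<And>x n m. ray x \<Longrightarrow> n \<le> m \<Longrightarrow> d (x 0) (x n) + d (x n) (x m) \<le> d (x 0) (x m) + R"
    using ray_stability by blast
  have "c * real n - R - d \<one> (x 0) \<le> gromov_product G S \<one> (x i) (y j)"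
    if x: "ray x" and y: "ray y" and 0: "x 0 = y 0" and n: "x n = y n" and i: "n \<le> i" and j: "n \<le> j" for x y n i j
  proof -
    have "d (x i) (y j) \<le> d (x n) (x i) + d (y n) (y j)"
      using d_triangle[of "x i" "x n" "y j"] d_sym[of "x i" "x n"] ray_carrier x y n by simp
    moreover have "c * real n \<le> d (x 0) (x n)" using ray_dist_ge[OF x, of 0 n] by simp
    moreover have "gromov_product G S (x 0) (x i) (y j) - d \<one> (x 0) \<le> gromov_product G S \<one> (x i) (y j)"
      using x y ray_carrier by (intro gromov_product_change_base) auto
    ultimately show ?thesis
      using R[OF x i] R[OF y j, folded 0 n] n unfolding gromov_product_def by (simp add: field_simps)
  qed
  with that show ?thesis by blast
qed

lemma ray_converging: "ray x \<Longrightarrow> converging_at_infinity G S x"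
proof -
  assume x: "ray x"
  obtain R where R: "\<And>x y n i j. ray x \<Longrightarrow> ray y \<Longrightarrow> x 0 = y 0 \<Longrightarrow> x n = y n \<Longrightarrow> n \<le> i \<Longrightarrow> n \<le> j \<Longrightarrow>
    c * real n - R - d \<one> (x 0) \<le> gromov_product G S \<one> (x i) (y j)"
    using ray_gromov_product by blast
  have "\<exists>N. \<forall>i\<ge>N. \<forall>j\<ge>N. r \<le> gromov_product G S \<one> (x i) (x j)" for r
  proof -
    obtain n :: nat where "(r + R + d \<one> (x 0)) / c < real n" using reals_Archimedean2 by blast
    then have "r + R + d \<one> (x 0) < c * real n" using c by (simp add: field_simps)
    then have "r \<le> gromov_product G S \<one> (x i) (x j)" if "n \<le> i" "n \<le> j" for i j
      using R[OF x x HOL.refl HOL.refl that] by linarith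
    then show ?thesis by blast
  qed
  then show ?thesis using x ray_range by (simp add: converging_iff gp_unbounded_def)
qed

lemma ray_ends_in_boundary: "ray_ends \<subseteq> gromov_boundary G S"
  using ray_converging endpoint_in_boundary by (auto simp: ray_ends_def)

lemma ray_ends_nonempty: "ray_ends \<noteq> {}"
  using ray_exists[OF one_closed] by (metis empty_iff image_eqI mem_Collect_eq ray_ends_def)

lemma ray_ends_invariant:
  assumes g: "g \<in> carrier G"
  shows "boundary_act G g ` ray_ends = ray_ends"
proof -
  have sub: "boundary_act G h ` ray_ends \<subseteq> ray_ends" if "h \<in> carrier G" for h
    using ray_translate[OF that] boundary_act_endpoint[OF that ray_range] by (auto simp: ray_ends_def)
  have "ray_ends \<subseteq> boundary_act G g ` ray_ends"
  proof
    fix \<xi> assume "\<xi> \<in> ray_ends"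
    then obtain x where x: "ray x" "\<xi> = endpoint x" by (auto simp: ray_ends_def)
    let ?y = "\<lambda>i. inv g \<otimes> x i"
    have y: "ray ?y" using g x ray_translate by simp
    have "boundary_act G g (endpoint ?y) = endpoint (\<lambda>i. g \<otimes> (inv g \<otimes> x i))"
      using boundary_act_endpoint[OF g ray_range[OF y]] .
    also have "(\<lambda>i. g \<otimes> (inv g \<otimes> x i)) = x"
      using g ray_carrier[OF x(1)] by (simp add: mult_inv_cancel_left)
    finally show "\<xi> \<in> boundary_act G g ` ray_ends"
      using y x(2) by (auto simp: ray_ends_def)
  qed
  with sub[OF g] show ?thesis by blast
qed

subsection \<open>Paths between endpoints of rays\<close>

text \<open>The new rays start at the second vertices, so that each level of the subdivision
  advances by one up step.\<close>

lemma merging_rays_exist: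
  assumes a: "ray a" and b: "ray b" and ab: "a 0 = b 0"
  shows "\<exists>m. ray (fst m) \<and> ray (snd m) \<and> fst m 0 = a 1 \<and> snd m 0 = b 1 \<and> endpoint (fst m) = endpoint (snd m)"
proof -
  have X: "a 1 \<in> carrier G" "b 1 \<in> carrier G" "a 0 \<in> carrier G"
    using a b ray_carrier by auto
  have "d (a 1) (b 1) \<le> d (a 0) (a 1) + d (b 0) (b 1)"
    using d_triangle[OF X(1,3,2)] d_sym[OF X(1,3)] ab by simp
  then have "d (a 1) (b 1) \<le> 2 * C"
    using E_dist[OF ray_step[OF a, of 0]] E_dist[OF ray_step[OF b, of 0]] by simp
  then obtain z where z: "E\<^sup>*\<^sup>* (a 1) z" "E\<^sup>*\<^sup>* (b 1) z" using E_confluent X by blast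
  have "z \<in> carrier G" using z(1) X(1) E_carrier by (induction rule: rtranclp_induct) auto
  then obtain r where r: "ray r" "r 0 = z" using ray_exists by blast
  obtain u where "ray u" "u 0 = a 1" "endpoint u = endpoint r" using ray_prepend[OF z(1) r] .
  moreover obtain v where "ray v" "v 0 = b 1" "endpoint v = endpoint r" using ray_prepend[OF z(2) r] .
  ultimately show ?thesis by (intro exI[of _ "(u, v)"]) auto
qed

definition merging_rays :: "(nat \<Rightarrow> 'a) \<Rightarrow> (nat \<Rightarrow> 'a) \<Rightarrow> (nat \<Rightarrow> 'a) \<times> (nat \<Rightarrow> 'a)" where
  "merging_rays a b = (SOME m. ray (fst m) \<and> ray (snd m) \<and> fst m 0 = a 1 \<and> snd m 0 = b 1 \<and>
     endpoint (fst m) = endpoint (snd m))"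

lemma merging_rays:
  assumes "ray a" "ray b" "a 0 = b 0"
  shows "ray (fst (merging_rays a b))" "ray (snd (merging_rays a b))"
    "fst (merging_rays a b) 0 = a 1" "snd (merging_rays a b) 0 = b 1"
    "endpoint (fst (merging_rays a b)) = endpoint (snd (merging_rays a b))"
  using someI_ex[OF merging_rays_exist[OF assms]] unfolding merging_rays_def by auto

text \<open>
  The pair \<open>subdivision a b n k\<close> consists of two rays with a common starting point whose endpoints
  are the values at \<open>k / 2 ^ n\<close> and \<open>(k + 1) / 2 ^ n\<close> of the path under construction from
  \<open>endpoint a\<close> to \<open>endpoint b\<close>. The pairs with \<open>k \<ge> 2 ^ n\<close> only serve to avoid a case distinction
  at the right end point.
\<close>

primrec subdivision :: "(nat \<Rightarrow> 'a) \<Rightarrow> (nat \<Rightarrow> 'a) \<Rightarrow> nat \<Rightarrow> nat \<Rightarrow> (nat \<Rightarrow> 'a) \<times> (nat \<Rightarrow> 'a)" where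
  "subdivision a b 0 = (\<lambda>k. if k = 0 then (a, b) else (b, b))"
| "subdivision a b (Suc n) = (\<lambda>k.
     let (x, y) = subdivision a b n (k div 2)
     in if even k then (\<lambda>i. x (Suc i), fst (merging_rays x y))
        else (snd (merging_rays x y), \<lambda>i. y (Suc i)))"

abbreviation left_ray where "left_ray a b n k \<equiv> fst (subdivision a b n k)"
abbreviation right_ray where "right_ray a b n k \<equiv> snd (subdivision a b n k)"

lemma subdivision_even:
  "left_ray a b (Suc n) (2 * k) = (\<lambda>i. left_ray a b n k (Suc i))"
  "right_ray a b (Suc n) (2 * k) = fst (merging_rays (left_ray a b n k) (right_ray a b n k))"
  by (simp_all add: Let_def split: prod.split)

lemma subdivision_odd:
  "left_ray a b (Suc n) (Suc (2 * k)) = snd (merging_rays (left_ray a b n k) (right_ray a b n k))"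
  "right_ray a b (Suc n) (Suc (2 * k)) = (\<lambda>i. right_ray a b n k (Suc i))"
  by (simp_all add: Let_def split: prod.split)

lemmas subdivision_simps = subdivision_even subdivision_odd

lemma even_odd_cases:
  fixes k :: nat
  obtains j where "k = 2 * j" | j where "k = Suc (2 * j)"
  by (metis evenE oddE Suc_eq_plus1)

text \<open>Passing to the left half only drops the first vertex, so the leftmost branch below a
  node traces its left ray.\<close>

lemma left_ray_shift: "left_ray a b (n + m) (2 ^ m * k) = (\<lambda>i. left_ray a b n k (m + i))"
proof (induction m)
  case (Suc m)
  have "left_ray a b (n + Suc m) (2 ^ Suc m * k) = left_ray a b (Suc (n + m)) (2 * (2 ^ m * k))"
    by (simp add: mult.assoc del: subdivision.simps)
  also have "\<dots> = (\<lambda>i. left_ray a b n k (Suc m + i))"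
    unfolding subdivision_even Suc.IH by simp
  finally show ?case .
qed simp

text \<open>The mirror image; \<open>2 ^ m * Suc k - 1\<close> is the last descendant of
  \<open>k\<close> after \<open>m\<close> levels.\<close>

lemma right_ray_shift:
  "right_ray a b (n + m) (2 ^ m * Suc k - 1) = (\<lambda>i. right_ray a b n k (m + i))"
proof (induction m)
  case (Suc m)
  have "1 \<le> 2 ^ m * Suc k" by (simp only: One_nat_def Suc_le_eq) simp
  then have "2 ^ Suc m * Suc k - 1 = Suc (2 * (2 ^ m * Suc k - 1))"
    unfolding power_Suc mult.assoc by linarith
  then have "right_ray a b (n + Suc m) (2 ^ Suc m * Suc k - 1)
      = right_ray a b (Suc (n + m)) (Suc (2 * (2 ^ m * Suc k - 1)))"
    by (simp del: subdivision.simps)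
  also have "\<dots> = (\<lambda>i. right_ray a b n k (Suc m + i))"
    unfolding subdivision_odd Suc.IH by simp
  finally show ?case .
qed simp

section \<open>The binary tree of vertices and its branches\<close>

context
  fixes a b :: "nat \<Rightarrow> 'a"
  assumes a: "ray a" and b: "ray b" and ab: "a 0 = b 0"
begin

lemma subdivision_rays:
  "ray (left_ray a b n k) \<and> ray (right_ray a b n k) \<and> left_ray a b n k 0 = right_ray a b n k 0"
proof (induction n arbitrary: k)
  case 0
  then show ?case using a b ab by simp
next
  case (Suc n)
  show ?case
  proof (cases k rule: even_odd_cases)
    case (1 j)
    show ?thesis
      unfolding 1 subdivision_even
      using Suc.IH[of j] merging_rays[of "left_ray a b n j" "right_ray a b n j"] by (simp add: ray_tl)
  next
    case (2 j)
    show ?thesis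
      unfolding 2 subdivision_odd
      using Suc.IH[of j] merging_rays[of "left_ray a b n j" "right_ray a b n j"] by (simp add: ray_tl)
  qed
qed

lemmas left_ray = subdivision_rays[THEN conjunct1]
  and right_ray = subdivision_rays[THEN conjunct2, THEN conjunct1]
  and left_right_start = subdivision_rays[THEN conjunct2, THEN conjunct2]

definition vertex :: "nat \<Rightarrow> nat \<Rightarrow> 'a" where
  "vertex n k = left_ray a b n k 0"

lemma vertex_0: "vertex 0 k = a 0"
  by (simp add: vertex_def ab)

text \<open>The children of a node start at the second vertices of its two rays, and these rays
  share their first vertex. Hence every branch of the tree is a ray.\<close>

lemma vertex_step: "E (vertex n (k div 2)) (vertex (Suc n) k)"
proof (cases k rule: even_odd_cases)
  case (1 j)
  with ray_step[OF left_ray, of n j 0] show ?thesis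
    by (simp only: vertex_def subdivision_simps) simp
next
  case (2 j)
  have "snd (merging_rays (left_ray a b n j) (right_ray a b n j)) 0 = right_ray a b n j 1"
    by (rule merging_rays) (rule left_ray right_ray left_right_start)+
  with 2 ray_step[OF right_ray, of n j 0] left_right_start[of n j] show ?thesis
    by (simp only: vertex_def subdivision_simps) simp
qed

text \<open>The gluing condition at the dyadic points. Siblings are joined by a merging pair; other
  neighbours inherit the condition from their parents, because there only first vertices are
  dropped.\<close>

lemma endpoint_adjacent: "endpoint (right_ray a b n k) = endpoint (left_ray a b n (Suc k))"
proof (induction n arbitrary: k)
  case (Suc n)
  show ?case
  proof (cases k rule: even_odd_cases)
    case (1 j)
    then show ?thesis
      using merging_rays(5)[OF left_ray right_ray left_right_start, of n j]
      by (simp only: subdivision_simps)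
  next
    case (2 j)
    then have "Suc k = 2 * Suc j" by simp
    with 2 show ?thesis
      using Suc.IH[of j] endpoint_ray_tl[OF left_ray, of n "Suc j"] endpoint_ray_tl[OF right_ray, of n j]
      by (simp only: subdivision_simps)
  qed
qed simp

lemma ray_vertices: "(\<And>n. \<kappa> (Suc n) div 2 = \<kappa> n) \<Longrightarrow> ray (\<lambda>n. vertex n (\<kappa> n))"
  unfolding ray_def using vertex_step by metis

text \<open>The branch that follows the binary expansion of \<open>t\<close>: at level
  \<open>n\<close> it visits the dyadic interval, closed on the left, that contains
  \<open>t\<close>.\<close>

definition ray_at :: "real \<Rightarrow> nat \<Rightarrow> 'a" where
  "ray_at t n = vertex n (nat \<lfloor>2 ^ n * t\<rfloor>)"

text \<open>
  At a dyadic \<open>t > 0\<close> the path must also be reached from the left; there \<open>ray_below t\<close> differs from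
  \<open>ray_at t\<close> but has the same endpoint.
\<close>

definition ray_below :: "real \<Rightarrow> nat \<Rightarrow> 'a" where
  "ray_below t n = vertex n (nat (\<lceil>2 ^ n * t\<rceil> - 1))"

lemma nat_div_2: "nat k div 2 = nat (k div 2)"
  using nat_div_distrib'[of 2 k] by simp

lemma floor_double: "\<lfloor>2 * u :: real\<rfloor> div 2 = \<lfloor>u\<rfloor>"
  using floor_divide_real_eq_div[of 2 "2 * u"] by simp

text \<open>\<open>\<lceil>u\<rceil> - 1\<close> is the integer \<open>k\<close> with
  \<open>k < u \<le> k + 1\<close>, the index of an interval closed on the right; rounding half of
  the index for \<open>2 * u\<close> down gives its parent.\<close>

lemma ceiling_double: "(\<lceil>2 * u :: real\<rceil> - 1) div 2 = \<lceil>u\<rceil> - 1"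
proof -
  have "of_int (2 * (\<lceil>u\<rceil> - 1)) < 2 * u" by simp linarith
  then have "2 * (\<lceil>u\<rceil> - 1) < \<lceil>2 * u\<rceil>" by (simp only: less_ceiling_iff)
  moreover have "\<lceil>2 * u\<rceil> \<le> 2 * \<lceil>u\<rceil>" by (simp add: ceiling_le_iff)
  ultimately show ?thesis by presburger
qed

lemma ray_ray_at: "ray (ray_at t)"
  unfolding ray_at_def
  by (rule ray_vertices) (simp add: nat_div_2 mult.assoc floor_double)

lemma ray_ray_below: "ray (ray_below t)"
  unfolding ray_below_def
  by (rule ray_vertices) (simp add: nat_div_2 mult.assoc ceiling_double)

lemma ray_at_0: "ray_at t 0 = a 0" and ray_below_0: "ray_below t 0 = a 0"
  by (simp_all add: ray_at_def ray_below_def vertex_0)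

text \<open>From level \<open>n\<close> on the branch keeps to leftmost descendants, that is, it
  follows the left ray of node \<open>k\<close>.\<close>

lemma endpoint_ray_at_dyadic:
  assumes "2 ^ n * t = real k"
  shows "endpoint (ray_at t) = endpoint (left_ray a b n k)"
proof -
  have "ray_at t (n + m) = left_ray a b n k m" for m
  proof -
    have "2 ^ (n + m) * t = 2 ^ m * (2 ^ n * t)" by (simp add: power_add)
    then have "2 ^ (n + m) * t = real (2 ^ m * k)" unfolding assms by simp
    then have "nat \<lfloor>2 ^ (n + m) * t\<rfloor> = 2 ^ m * k" by (simp only: floor_of_nat nat_int)
    then show ?thesis using left_ray_shift[of a b n m k] by (simp add: ray_at_def vertex_def)
  qed
  then show ?thesis using endpoint_ray_shift[OF ray_ray_at[of t], of n] by simp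
qed

lemma endpoint_ray_below_dyadic:
  assumes "2 ^ n * t = real (Suc k)"
  shows "endpoint (ray_below t) = endpoint (right_ray a b n k)"
proof -
  have "ray_below t (n + m) = right_ray a b n k m" for m
  proof -
    have "2 ^ (n + m) * t = 2 ^ m * (2 ^ n * t)" by (simp add: power_add)
    then have "2 ^ (n + m) * t = real (2 ^ m * Suc k)" unfolding assms by (simp add: algebra_simps)
    then have "nat (\<lceil>2 ^ (n + m) * t\<rceil> - 1) = 2 ^ m * Suc k - 1"
      by (simp only: ceiling_of_nat nat_diff_distrib)
    then show ?thesis
      using right_ray_shift[of a b n m k] left_right_start[of "n + m" "2 ^ m * Suc k - 1"]
      by (simp add: ray_below_def vertex_def)
  qed
  then show ?thesis using endpoint_ray_shift[OF ray_ray_below[of t], of n] by simp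
qed

text \<open>If \<open>2 ^ n * t\<close> is not an integer, every \<open>s\<close> near
  \<open>t\<close> has the same index at level \<open>n\<close> and \<open>ray_at t\<close> itself
  serves. If it is an integer, an \<open>s\<close> just to the left has the preceding index, and
  there \<open>ray_below t\<close> serves.\<close>

lemma ray_at_near:
  assumes t: "0 \<le> t"
  shows "\<exists>\<epsilon>>0. \<forall>s\<ge>0. \<bar>s - t\<bar> < \<epsilon> \<longrightarrow>
    (\<exists>x. ray x \<and> endpoint x = endpoint (ray_at t) \<and> x 0 = a 0 \<and> x n = ray_at s n)"
proof -
  let ?k = "\<lfloor>2 ^ n * t\<rfloor>"
  define u where "u = 2 ^ n * t"
  have scaled: "\<bar>2 ^ n * s - u\<bar> = 2 ^ n * \<bar>s - t\<bar>" for s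
  proof -
    have "2 ^ n * s - u = 2 ^ n * (s - t)" by (simp only: u_def right_diff_distrib)
    then show ?thesis by (simp add: abs_mult)
  qed
  have same: "\<exists>x. ray x \<and> endpoint x = endpoint (ray_at t) \<and> x 0 = a 0 \<and> x n = ray_at s n"
    if "\<lfloor>2 ^ n * s\<rfloor> = ?k" for s
    using that ray_ray_at ray_at_0 by (intro exI[of _ "ray_at t"]) (simp add: ray_at_def)
  show ?thesis
  proof (cases "u = of_int \<lfloor>u\<rfloor>")
    case True
    have "\<exists>x. ray x \<and> endpoint x = endpoint (ray_at t) \<and> x 0 = a 0 \<and> x n = ray_at s n"
      if s: "0 \<le> s" "\<bar>s - t\<bar> < 1 / 2 ^ n" for s
    proof (cases "\<lfloor>2 ^ n * s\<rfloor> = ?k")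
      case False
      have "\<bar>2 ^ n * s - u\<bar> = 2 ^ n * \<bar>s - t\<bar>" by (rule scaled)
      also have "\<dots> < 1" using s(2) by (simp add: field_simps)
      finally have "\<bar>2 ^ n * s - u\<bar> < 1" .
      then have fl: "\<lfloor>2 ^ n * s\<rfloor> = \<lfloor>u\<rfloor> - 1" using True False unfolding u_def by linarith
      define j where "j = nat \<lfloor>2 ^ n * s\<rfloor>"
      have "int j = \<lfloor>2 ^ n * s\<rfloor>" using s(1) by (simp add: j_def)
      with fl have j: "\<lfloor>u\<rfloor> = int (Suc j)" by simp
      \<comment> \<open>So the intervals \<open>j\<close> and \<open>Suc j\<close> of level
        \<open>n\<close> meet at \<open>t\<close>, and \<open>endpoint_adjacent\<close>
        applies.\<close>
      have uj: "2 ^ n * t = real (Suc j)" using True j unfolding u_def by simp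
      have cl: "\<lceil>2 ^ n * t\<rceil> = int (Suc j)" unfolding uj by (rule ceiling_of_nat)
      have "endpoint (ray_below t) = endpoint (ray_at t)"
        using endpoint_ray_below_dyadic[OF uj] endpoint_ray_at_dyadic[OF uj] endpoint_adjacent by simp
      moreover have "ray_below t n = ray_at s n"
        using cl by (simp add: ray_below_def ray_at_def j_def)
      ultimately show ?thesis using ray_ray_below ray_below_0 by blast
    qed (rule same)
    then show ?thesis by (intro exI[of _ "1 / 2 ^ n"]) auto
  next
    case False
    \<comment> \<open>The distance from \<open>u\<close> to the nearest integer, scaled back to
      level 0.\<close>
    define \<epsilon> where "\<epsilon> = min (u - \<lfloor>u\<rfloor>) (\<lfloor>u\<rfloor> + 1 - u) / 2 ^ n"
    have "of_int \<lfloor>u\<rfloor> < u" "u < of_int \<lfloor>u\<rfloor> + 1" using False by linarith+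
    then have "0 < \<epsilon>" unfolding \<epsilon>_def by simp
    moreover have "\<lfloor>2 ^ n * s\<rfloor> = ?k" if s: "\<bar>s - t\<bar> < \<epsilon>" for s
    proof -
      have "\<bar>2 ^ n * s - u\<bar> = 2 ^ n * \<bar>s - t\<bar>" by (rule scaled)
      also have "\<dots> < min (u - \<lfloor>u\<rfloor>) (\<lfloor>u\<rfloor> + 1 - u)"
        using s unfolding \<epsilon>_def by (simp add: field_simps)
      finally have "\<bar>2 ^ n * s - u\<bar> < u - \<lfloor>u\<rfloor>" "\<bar>2 ^ n * s - u\<bar> < \<lfloor>u\<rfloor> + 1 - u" by simp_all
      then have "\<lfloor>u\<rfloor> < 2 ^ n * s" "2 ^ n * s < \<lfloor>u\<rfloor> + 1" by linarith+
      then show ?thesis unfolding u_def[symmetric] by (intro floor_unique) auto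
    qed
    ultimately show ?thesis using same by blast
  qed
qed

lemma endpoint_ray_at_open:
  assumes U: "openin (boundary_topology G S) U" and t: "0 \<le> t" and tU: "endpoint (ray_at t) \<in> U"
  shows "\<exists>\<epsilon>>0. \<forall>s\<ge>0. \<bar>s - t\<bar> < \<epsilon> \<longrightarrow> endpoint (ray_at s) \<in> U"
proof -
  obtain r where r: "boundary_nbhd G S (endpoint (ray_at t)) r \<subseteq> U"
    using U tU unfolding openin_boundary_topology by blast
  obtain R where R: "\<And>x y n i j. ray x \<Longrightarrow> ray y \<Longrightarrow> x 0 = y 0 \<Longrightarrow> x n = y n \<Longrightarrow> n \<le> i \<Longrightarrow> n \<le> j \<Longrightarrow>
    c * real n - R - d \<one> (x 0) \<le> gromov_product G S \<one> (x i) (y j)"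
    using ray_gromov_product by blast
  \<comment> \<open>All branches start at \<open>a 0\<close>, so this level does not depend on
    \<open>s\<close>.\<close>
  obtain n :: nat where "(r + R + d \<one> (a 0)) / c < real n" using reals_Archimedean2 by blast
  then have n: "r + R + d \<one> (a 0) < c * real n" using c by (simp add: field_simps)
  obtain \<epsilon> where e: "0 < \<epsilon>" "\<And>s. 0 \<le> s \<Longrightarrow> \<bar>s - t\<bar> < \<epsilon> \<Longrightarrow>
    \<exists>x. ray x \<and> endpoint x = endpoint (ray_at t) \<and> x 0 = a 0 \<and> x n = ray_at s n"
    using ray_at_near[OF t, of n] by blast
  have "endpoint (ray_at s) \<in> U" if s: "0 \<le> s" "\<bar>s - t\<bar> < \<epsilon>" for s
  proof -
    obtain x where x: "ray x" "endpoint x = endpoint (ray_at t)" "x 0 = a 0" "x n = ray_at s n"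
      using e(2)[OF s] by blast
    \<comment> \<open>The representative \<open>x\<close> depends on \<open>s\<close>, but the
      neighbourhood only on its class, which is that of \<open>ray_at t\<close>.\<close>
    have "endpoint (ray_at s) \<in> boundary_nbhd G S (endpoint x) r"
    proof (rule endpoint_in_nbhd)
      fix i j assume "n \<le> i" "n \<le> j"
      then have "c * real n - R - d \<one> (x 0) \<le> gromov_product G S \<one> (x i) (ray_at s j)"
        using x ray_ray_at ray_at_0 by (intro R) auto
      then show "r \<le> gromov_product G S \<one> (x i) (ray_at s j)" using n x(3) by simp
    qed (use x ray_ray_at ray_converging in auto)
    then show ?thesis using r x(2) by auto
  qed
  with e(1) show ?thesis by blast
qed

lemma path_component_common_start:
  "path_component_of (subtopology (boundary_topology G S) ray_ends) (endpoint a) (endpoint b)"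
proof -
  let ?f = "\<lambda>t. endpoint (ray_at t)"
  have f_ends: "?f t \<in> ray_ends" for t using ray_ray_at by (auto simp: ray_ends_def)
  have "pathin (boundary_topology G S) ?f"
    unfolding pathin_def continuous_map_def
  proof (intro conjI allI impI)
    show "?f \<in> topspace (top_of_set {0..1}) \<rightarrow> topspace (boundary_topology G S)"
      using f_ends ray_ends_in_boundary by (auto simp: topspace_boundary_topology)
    fix U assume U: "openin (boundary_topology G S) U"
    show "openin (top_of_set {0..1}) {x \<in> topspace (top_of_set {0..1}). ?f x \<in> U}"
      unfolding openin_euclidean_subtopology_iff
    proof (intro conjI ballI)
      fix t assume "t \<in> {x \<in> topspace (top_of_set {0..1}). ?f x \<in> U}"
      then have "0 \<le> t" "?f t \<in> U" by auto
      then obtain e where "e > 0" "\<forall>s\<ge>0. \<bar>s - t\<bar> < e \<longrightarrow> ?f s \<in> U"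
        using endpoint_ray_at_open[OF U] by blast
      then show "\<exists>e>0. \<forall>x'\<in>{0..1}. dist x' t < e \<longrightarrow> x' \<in> {x \<in> topspace (top_of_set {0..1}). ?f x \<in> U}"
        by (auto simp: dist_real_def)
    qed auto
  qed
  moreover have "?f 0 = endpoint a" using endpoint_ray_at_dyadic[of 0 0 0] by simp
  \<comment> \<open>At level 0 the point 1 has index 1, where \<open>subdivision\<close> supplies
    \<open>(b, b)\<close>, with left ray \<open>b\<close>.\<close>
  moreover have "?f 1 = endpoint b" using endpoint_ray_at_dyadic[of 0 1 1] by simp
  ultimately show ?thesis
    unfolding path_component_of_def pathin_subtopology using f_ends by blast
qed

end

lemma path_connectedin_ray_ends: "path_connectedin (boundary_topology G S) ray_ends"
proof -
  let ?X = "subtopology (boundary_topology G S) ray_ends"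
  \<comment> \<open>Quantifying over all rays makes this reflexive by the case of a common start,
    and transitive through any ray from the middle vertex. As \<open>1 \<le> 2 * C\<close>,
    confluence links neighbours in the Cayley graph, and words link the rest.\<close>
  define linked where "linked g h \<longleftrightarrow> (\<forall>x y. ray x \<longrightarrow> ray y \<longrightarrow> x 0 = g \<longrightarrow> y 0 = h \<longrightarrow>
    path_component_of ?X (endpoint x) (endpoint y))" for g h
  have linked_refl: "linked g g" for g
    using path_component_common_start by (auto simp: linked_def)
  have linked_trans: "linked g k" if "linked g h" "linked h k" "h \<in> carrier G" for g h k
    unfolding linked_def
  proof (intro allI impI)
    fix x y assume xy: "ray x" "ray y" "x 0 = g" "y 0 = k"
    obtain r where r: "ray r" "r 0 = h" using ray_exists \<open>h \<in> carrier G\<close> by blast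
    show "path_component_of ?X (endpoint x) (endpoint y)"
      by (rule path_component_of_trans[of _ _ "endpoint r"]) (use that(1,2) xy r in \<open>auto simp: linked_def\<close>)
  qed
  have linked_generator: "linked g (g \<otimes> s)" if g: "g \<in> carrier G" and s: "s \<in> S" for g s
    unfolding linked_def
  proof (intro allI impI)
    fix x y assume x: "ray x" "x 0 = g" and y: "ray y" "y 0 = g \<otimes> s"
    have sc: "s \<in> carrier G" using s S_carrier by blast
    have "d g (g \<otimes> s) \<le> 1" using d_mult_right[OF g sc] len_generator[OF s] by simp
    then obtain z where z: "E\<^sup>*\<^sup>* g z" "E\<^sup>*\<^sup>* (g \<otimes> s) z"
      using E_confluent[of g "g \<otimes> s"] g sc C by auto
    have "z \<in> carrier G" using z(1) g E_carrier by (induction rule: rtranclp_induct) auto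
    then obtain r where r: "ray r" "r 0 = z" using ray_exists by blast
    obtain u where u: "ray u" "u 0 = g" "endpoint u = endpoint r" using ray_prepend[OF z(1) r] .
    obtain v where v: "ray v" "v 0 = g \<otimes> s" "endpoint v = endpoint r" using ray_prepend[OF z(2) r] .
    have "path_component_of ?X (endpoint x) (endpoint r)"
      using path_component_common_start[OF x(1) u(1)] x(2) u by simp
    moreover have "path_component_of ?X (endpoint r) (endpoint y)"
      using path_component_common_start[OF v(1) y(1)] y(2) v by simp
    ultimately show "path_component_of ?X (endpoint x) (endpoint y)" by (rule path_component_of_trans)
  qed
  have linked_word: "linked g (g \<otimes> word w)" if "set w \<subseteq> S" "g \<in> carrier G" for g w
    using that
  proof (induction w arbitrary: g)
    case Nil
    then show ?case using linked_refl by simp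
  next
    case (Cons s w)
    then have s: "s \<in> S" "s \<in> carrier G" and w: "word w \<in> carrier G"
      using S_carrier word_closed_S by auto
    have "linked (g \<otimes> s) ((g \<otimes> s) \<otimes> word w)" using Cons s by auto
    with linked_trans[OF linked_generator[OF Cons.prems(2) s(1)]] s w Cons.prems show ?case
      by (simp add: m_assoc)
  qed
  have "linked g h" if gh: "g \<in> carrier G" "h \<in> carrier G" for g h
  proof -
    obtain w where "set w \<subseteq> S" "word w = inv g \<otimes> h" using word_exists[of "inv g \<otimes> h"] gh by auto
    then show ?thesis using linked_word[of w g] gh by (simp add: mult_inv_cancel_left)
  qed
  then have "path_component_of ?X (endpoint x) (endpoint y)" if "ray x" "ray y" for x y
    using that ray_carrier unfolding linked_def by blast
  then have "path_connected_space ?X"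
    unfolding path_connected_space_iff_path_component using ray_ends_in_boundary
    by (auto simp: ray_ends_def)
  then show ?thesis
    using ray_ends_in_boundary by (simp add: path_connectedin_def topspace_boundary_topology)
qed

end

section \<open>Disjointness of the two sets of endpoints\<close>

text \<open>
  A common boundary point would make the backwards ray \<open>y\<close> followed by the ray \<open>x\<close> a quasigeodesic
  between points with unbounded Gromov product.
\<close>

lemma (in hyperbolic_word_metric) ray_ends_disjoint:
  assumes "hyperbolic_up_steps G S E C c \<phi>" "hyperbolic_up_steps G S E' C' c' \<psi>"
    and E_down: "\<And>x y. E x y \<Longrightarrow> \<psi> y \<le> \<psi> x" and E'_down: "\<And>x y. E' x y \<Longrightarrow> \<phi> y \<le> \<phi> x"
  shows "hyperbolic_up_steps.ray_ends G S E \<inter> hyperbolic_up_steps.ray_ends G S E' = {}"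
proof -
  interpret up: hyperbolic_up_steps G S E C c \<phi> by fact
  interpret down: hyperbolic_up_steps G S E' C' c' \<psi> by fact
  have False if x: "up.ray x" and y: "down.ray y" and xy: "endpoint x = endpoint y" for x y
  proof -
    have xc: "x i \<in> carrier G" and yc: "y i \<in> carrier G" for i
      using up.ray_carrier[OF x] down.ray_carrier[OF y] by auto
    have "x \<in> endpoint y" using endpoint_self[OF up.ray_converging[OF x]] xy by simp
    then have unbounded: "gp_unbounded y x" by (simp add: boundary_rel_iff)
    define D where "D = d (y 0) (x 0)"
    \<comment> \<open>\<open>D\<close> is the length of the step joining \<open>y 0\<close> to
      \<open>x 0\<close>, and \<open>1 / c + 1 / c'\<close> arises from adding two height estimates.
      In \<open>e\<close>, the \<open>D\<close> pays for the different starting points and the 1 for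
      the joining step.\<close>
    define l where "l = C + C' + D + 1 / c + 1 / c' + 1"
    define e where "e = (1 / c + 1 / c') * D + 1"
    have inv_pos: "0 < 1 / c" "0 < 1 / c'" and D: "0 \<le> D"
      using up.c down.c d_nonneg by (auto simp: D_def)
    have l: "1 \<le> l" "C \<le> l" "C' \<le> l" "D \<le> l" "1 / c \<le> l" "1 / c' \<le> l" "1 / c + 1 / c' \<le> l"
      using inv_pos D up.C down.C by (auto simp: l_def)
    have e: "0 \<le> e" using inv_pos D by (simp add: e_def)
    have lower_x: "real (j - i) \<le> l * d (x i) (x j) + e" if "i \<le> j" for i j
    proof -
      have "real (j - i) \<le> 1 / c * d (x i) (x j)"
        using up.ray_dist_ge[OF x that] up.c by (simp add: field_simps)
      also have "\<dots> \<le> l * d (x i) (x j)" using l d_nonneg by (intro mult_right_mono) auto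
      finally show ?thesis using e by simp
    qed
    have lower_y: "real (j - i) \<le> l * d (y j) (y i) + e" if "i \<le> j" for i j
    proof -
      have "real (j - i) \<le> 1 / c' * d (y i) (y j)"
        using down.ray_dist_ge[OF y that] down.c by (simp add: field_simps)
      also have "\<dots> \<le> l * d (y i) (y j)" using l d_nonneg by (intro mult_right_mono) auto
      finally show ?thesis using e d_sym[OF yc yc, of i j] by simp
    qed
    have psi_x: "\<psi> (x i) \<le> \<psi> (x 0)" for i
      using E_down[OF up.ray_step[OF x]] by (induction i) (auto intro: order_trans)
    have phi_y: "\<phi> (y i) \<le> \<phi> (y 0)" for i
      using E'_down[OF down.ray_step[OF y]] by (induction i) (auto intro: order_trans)
    \<comment> \<open>\<open>\<phi>\<close> climbs along \<open>x\<close> but not along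
      \<open>y\<close>, so the distance controls \<open>i\<close>; in the same way
      \<open>\<psi>\<close> controls \<open>j\<close>.\<close>
    have lower_xy: "real (i + j + 1) \<le> l * d (y j) (x i) + e" for i j
    proof -
      have "c * real i \<le> d (y j) (x i) + D"
        using up.ray_height[OF x, of 0 i] phi_y[of j] up.height_lipschitz[OF yc xc, of j i]
          up.height_lipschitz[OF yc xc, of 0 0] unfolding D_def by simp
      then have i: "real i \<le> 1 / c * (d (y j) (x i) + D)" using up.c by (simp add: field_simps)
      have "c' * real j \<le> d (y j) (x i) + D"
        using down.ray_height[OF y, of 0 j] psi_x[of i] down.height_lipschitz[OF yc xc, of j i]
          down.height_lipschitz[OF yc xc, of 0 0] unfolding D_def by simp
      then have j: "real j \<le> 1 / c' * (d (y j) (x i) + D)" using down.c by (simp add: field_simps)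
      have "real (i + j + 1) \<le> (1 / c + 1 / c') * d (y j) (x i) + e"
        using i j unfolding e_def distrib_left distrib_right by simp
      also have "\<dots> \<le> l * d (y j) (x i) + e"
        using l d_nonneg by (intro add_mono mult_right_mono) auto
      finally show ?thesis .
    qed
    obtain R where R: "\<And>p N n. (\<And>i. i \<le> N \<Longrightarrow> p i \<in> carrier G) \<Longrightarrow>
       (\<And>i. i < N \<Longrightarrow> d (p i) (p (Suc i)) \<le> l) \<Longrightarrow>
       (\<And>i j. i \<le> j \<Longrightarrow> j \<le> N \<Longrightarrow> real (j - i) \<le> l * d (p i) (p j) + e) \<Longrightarrow> n \<le> N \<Longrightarrow>
       d (p 0) (p n) + d (p n) (p N) \<le> d (p 0) (p N) + R"
      using quasigeodesic_stability[OF l(1) e] by blast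
    have R_xy: "d (y j) (y 0) + d (y 0) (x i) \<le> d (y j) (x i) + R" for i j
    proof -
      \<comment> \<open>From \<open>y j\<close> back to \<open>y 0\<close>, which is
        \<open>p j\<close>, then along \<open>x\<close> from index \<open>Suc j\<close>. Stability
        is applied at \<open>p j\<close>.\<close>
      define p where "p k = (if k \<le> j then y (j - k) else x (k - Suc j))" for k
      have "d (p 0) (p j) + d (p j) (p (Suc (j + i))) \<le> d (p 0) (p (Suc (j + i))) + R"
      proof (rule R)
        fix k show "p k \<in> carrier G" using xc yc by (simp add: p_def)
        show "d (p k) (p (Suc k)) \<le> l"
        proof (cases "k < j")
          case True
          then have "d (p k) (p (Suc k)) = d (y (j - Suc k)) (y (Suc (j - Suc k)))"
            using d_sym[OF yc yc] by (simp add: p_def Suc_diff_Suc)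
          also have "\<dots> \<le> C'" using down.E_dist[OF down.ray_step[OF y]] .
          finally show ?thesis using l by simp
        next
          case False
          show ?thesis
          proof (cases "k = j")
            case True
            then show ?thesis using l by (simp add: p_def D_def)
          next
            case kj: False
            then have "d (p k) (p (Suc k)) = d (x (k - Suc j)) (x (Suc (k - Suc j)))"
              using False by (simp add: p_def Suc_diff_Suc)
            also have "\<dots> \<le> C" using up.E_dist[OF up.ray_step[OF x]] .
            finally show ?thesis using l by simp
          qed
        qed
      next
        fix k m :: nat assume km: "k \<le> m"
        consider "m \<le> j" | "k \<le> j" "j < m" | "j < k" using km by linarith
        then show "real (m - k) \<le> l * d (p k) (p m) + e"
        proof cases
          case 1
          then show ?thesis using lower_y[of "j - m" "j - k"] km by (simp add: p_def)
        next
          case 2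
          then show ?thesis using lower_xy[of "m - Suc j" "j - k"] by (simp add: p_def)
        next
          case 3
          then show ?thesis using lower_x[of "k - Suc j" "m - Suc j"] km by (simp add: p_def)
        qed
      qed simp
      then show ?thesis by (simp add: p_def)
    qed
    \<comment> \<open>Seen from \<open>y 0\<close>, stability caps the product at
      \<open>R / 2\<close>; the change of base point costs \<open>d (y 0) \<one>\<close>, so a value
      larger by 1 is contradictory.\<close>
    obtain N where N: "R / 2 + d (y 0) \<one> + 1 \<le> gromov_product G S \<one> (y N) (x N)"
      using unbounded unfolding gp_unbounded_def by blast
    have "gromov_product G S \<one> (y N) (x N) - d (y 0) \<one> \<le> gromov_product G S (y 0) (y N) (x N)"
      using xc yc by (intro gromov_product_change_base) auto
    also have "\<dots> \<le> R / 2"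
      using R_xy[of N N] d_sym[OF yc yc, of 0 N] by (simp add: gromov_product_def)
    finally show False using N by simp
  qed
  then show ?thesis unfolding up.ray_ends_def down.ray_ends_def by blast
qed

section \<open>Up steps of an almost periodic action\<close>

definition up_step :: "('a, 'b) monoid_scheme \<Rightarrow> 'a set \<Rightarrow> ('a \<Rightarrow> real \<Rightarrow> real) \<Rightarrow> real \<Rightarrow> 'a \<Rightarrow> 'a \<Rightarrow> bool" where
  "up_step G S \<rho> C x y \<longleftrightarrow> x \<in> carrier G \<and> y \<in> carrier G \<and> word_dist G S x y \<le> C \<and>
     up_element G \<rho> (inv\<^bsub>G\<^esub> x \<otimes>\<^bsub>G\<^esub> y)"

lemma up_path_imp_up_steps:
  assumes "up_path G S \<rho> C x z"
  shows "(up_step G S \<rho> C)\<^sup>*\<^sup>* x z"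
proof -
  from assms obtain m u where u: "u 0 = x" "u m = z" "\<And>i. i \<le> m \<Longrightarrow> u i \<in> carrier G"
    "\<And>i. i < m \<Longrightarrow> word_dist G S (u i) (u (Suc i)) \<le> C \<and> up_element G \<rho> (inv\<^bsub>G\<^esub> (u i) \<otimes>\<^bsub>G\<^esub> u (Suc i))"
    unfolding up_path_def by blast
  have "(up_step G S \<rho> C)\<^sup>*\<^sup>* (u 0) (u i)" if "i \<le> m" for i
    using that
  proof (induction i)
    case (Suc i)
    then have "up_step G S \<rho> C (u i) (u (Suc i))" using u by (simp add: up_step_def)
    with Suc show ?case by simp
  qed simp
  with u show ?thesis by blast
qed

context word_metric
begin

lemma up_step_translate:
  "g \<in> carrier G \<Longrightarrow> up_step G S \<rho> C x y \<Longrightarrow> up_step G S \<rho> C (g \<otimes> x) (g \<otimes> y)"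
  by (simp add: up_step_def d_translate inv_mult_translate)

lemma up_uniform_confluent:
  assumes "up_uniform G S \<rho>"
  obtains C where "1 \<le> C"
    "\<And>x y. x \<in> carrier G \<Longrightarrow> y \<in> carrier G \<Longrightarrow> d x y \<le> 2 * C \<Longrightarrow>
       \<exists>z. (up_step G S \<rho> C)\<^sup>*\<^sup>* x z \<and> (up_step G S \<rho> C)\<^sup>*\<^sup>* y z"
proof -
  obtain C where C: "1 \<le> C" "\<And>x y. x \<in> carrier G \<Longrightarrow> y \<in> carrier G \<Longrightarrow> d x y \<le> 2 * C \<Longrightarrow>
      \<exists>z\<in>carrier G. up_path G S \<rho> C x z \<and> up_path G S \<rho> C y z"
    using assms unfolding up_uniform_def by blast
  show ?thesis
  proof (rule that[OF C(1)])
    fix x y assume "x \<in> carrier G" "y \<in> carrier G" "d x y \<le> 2 * C"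
    then obtain z where "up_path G S \<rho> C x z" "up_path G S \<rho> C y z" using C(2) by blast
    then show "\<exists>z. (up_step G S \<rho> C)\<^sup>*\<^sup>* x z \<and> (up_step G S \<rho> C)\<^sup>*\<^sup>* y z"
      by (intro exI conjI up_path_imp_up_steps)
  qed
qed

lemma almost_periodic_nontrivial:
  assumes "almost_periodic G S \<rho>"
  obtains s where "s \<in> S" "s \<noteq> \<one>"
proof -
  interpret A: group_action G UNIV \<rho>
    using assms by (simp add: almost_periodic_def orientation_preserving_action_def)
  obtain s where s: "s \<in> S" "\<rho> s 0 - 0 \<ge> 1" using assms unfolding almost_periodic_def by blast
  have "\<rho> \<one> 0 = 0" by (simp add: A.id_eq_one[symmetric])
  with s(2) have "s \<noteq> \<one>" by auto
  with s(1) show ?thesis by (rule that)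
qed

text \<open>Confluence applies to the identity and a generator \<open>s\<close> different from it:
  without any up step both paths to \<open>z\<close> would be constant, forcing \<open>s\<close> to
  be the identity. Left translation carries the step so found to \<open>x\<close>.\<close>

lemma up_step_serial:
  assumes ap: "almost_periodic G S \<rho>" and C: "1 \<le> C"
    and confluent: "\<And>x y. x \<in> carrier G \<Longrightarrow> y \<in> carrier G \<Longrightarrow> d x y \<le> 2 * C \<Longrightarrow>
       \<exists>z. (up_step G S \<rho> C)\<^sup>*\<^sup>* x z \<and> (up_step G S \<rho> C)\<^sup>*\<^sup>* y z"
    and x: "x \<in> carrier G"
  shows "\<exists>y. up_step G S \<rho> C x y"
proof -
  obtain s where s: "s \<in> S" "s \<noteq> \<one>" using almost_periodic_nontrivial[OF ap] .
  have sc: "s \<in> carrier G" using s S_carrier by blast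
  have "d \<one> s \<le> 2 * C" using d_mult_right[OF one_closed sc] len_generator[OF s(1)] sc C by simp
  then obtain z where "(up_step G S \<rho> C)\<^sup>*\<^sup>* \<one> z" "(up_step G S \<rho> C)\<^sup>*\<^sup>* s z"
    using confluent[OF one_closed sc] by blast
  moreover have "v = w" if "\<nexists>v w. up_step G S \<rho> C v w" "(up_step G S \<rho> C)\<^sup>*\<^sup>* v w" for v w
    using that(2,1) by (induction rule: rtranclp_induct) auto
  ultimately have "\<exists>v w. up_step G S \<rho> C v w" using s(2) by blast
  then obtain v w where vw: "up_step G S \<rho> C v w" by blast
  then have "up_step G S \<rho> C (x \<otimes> inv v \<otimes> v) (x \<otimes> inv v \<otimes> w)"
    using x by (intro up_step_translate) (auto simp: up_step_def)
  moreover have "x \<otimes> inv v \<otimes> v = x" using vw x by (simp add: up_step_def m_assoc)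
  ultimately show ?thesis by auto
qed

text \<open>A step from \<open>x\<close> to \<open>y\<close> applies the inverse of a short up
  element to \<open>\<rho> (inv x) p\<close>, as in the definition of \<open>up_element\<close>.
  Only finitely many elements have length at most \<open>C\<close>, so their gains have a positive
  minimum.\<close>

lemma up_step_height:
  assumes "group_action G UNIV \<rho>"
  obtains c where "0 < c" "\<And>x y p. up_step G S \<rho> C x y \<Longrightarrow> \<rho> (inv x) p + c \<le> \<rho> (inv y) p"
proof -
  interpret A: group_action G UNIV \<rho> by fact
  define B where "B = {g. up_element G \<rho> g \<and> real (len g) \<le> C}"
  have B: "finite B"
    by (rule finite_subset[OF _ finite_ball[of C]]) (auto simp: B_def up_element_def)
  have "\<forall>g\<in>B. \<exists>c>0. \<forall>p. \<rho> (inv g) p - p \<ge> c" by (auto simp: B_def up_element_def)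
  then obtain f where f: "\<And>g. g \<in> B \<Longrightarrow> 0 < f g" "\<And>g p. g \<in> B \<Longrightarrow> \<rho> (inv g) p - p \<ge> f g"
    using bchoice[of B "\<lambda>g c. c > 0 \<and> (\<forall>p. \<rho> (inv g) p - p \<ge> c)"] by blast
  \<comment> \<open>Inserting 1 keeps the minimum defined when \<open>B\<close> is empty.\<close>
  define c where "c = Min (insert 1 (f ` B))"
  have c: "0 < c" using B f by (auto simp: c_def)
  have "\<rho> (inv x) p + c \<le> \<rho> (inv y) p" if "up_step G S \<rho> C x y" for x y p
  proof -
    let ?g = "inv x \<otimes> y"
    have X: "x \<in> carrier G" "y \<in> carrier G" and g: "?g \<in> B"
      using that by (auto simp: up_step_def B_def word_dist_def)
    have "inv y = inv ?g \<otimes> inv x" using X by (simp add: inv_mult_group m_assoc)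
    then have "\<rho> (inv y) p = \<rho> (inv ?g) (\<rho> (inv x) p)" using X A.composition_rule by simp
    moreover have "c \<le> f ?g" using B g by (auto simp: c_def)
    ultimately show ?thesis using f(2)[OF g, of "\<rho> (inv x) p"] by simp
  qed
  with c that show ?thesis by blast
qed

text \<open>Because of the inverse, passing from \<open>x\<close> to \<open>x \<otimes> s\<close>
  applies \<open>\<rho> (inv s)\<close> last, so the displacement bound for generators
  applies.\<close>

lemma almost_periodic_lipschitz:
  assumes "almost_periodic G S \<rho>"
  obtains L where "0 < L"
    "\<And>x y p. x \<in> carrier G \<Longrightarrow> y \<in> carrier G \<Longrightarrow> \<bar>\<rho> (inv x) p - \<rho> (inv y) p\<bar> \<le> L * d x y"
proof -
  interpret A: group_action G UNIV \<rho>
    using assms by (simp add: almost_periodic_def orientation_preserving_action_def)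
  obtain D where D: "\<And>s p. s \<in> S \<Longrightarrow> \<bar>\<rho> s p - p\<bar> \<le> D" using assms unfolding almost_periodic_def by blast
  define L where "L = max D 1"
  have "\<bar>\<rho> (inv x) p - \<rho> (inv y) p\<bar> \<le> L * d x y" if "x \<in> carrier G" "y \<in> carrier G" for x y p
  proof (rule lipschitz_on_generators[OF _ that])
    fix x s assume x: "x \<in> carrier G" and s: "s \<in> S"
    then have "\<rho> (inv (x \<otimes> s)) p = \<rho> (inv s) (\<rho> (inv x) p)"
      using S_carrier A.composition_rule by (auto simp: inv_mult_group)
    then show "\<bar>\<rho> (inv (x \<otimes> s)) p - \<rho> (inv x) p\<bar> \<le> L"
      using D[OF inv_S[OF s], of "\<rho> (inv x) p"] by (simp add: L_def)
  qed
  with that[of L] show ?thesis by (simp add: L_def)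
qed

end

text \<open>Dividing by the Lipschitz constant normalises the height. The base point
  \<open>p\<close> stays free so that the two actions can be evaluated at points matched by the
  conjugation.\<close>

lemma (in hyperbolic_word_metric) up_uniform_up_steps:
  assumes "up_uniform G S \<rho>"
  shows "\<exists>L C c. 0 < L \<and> hyperbolic_up_steps G S (up_step G S \<rho> C) C c (\<lambda>x. \<rho> (inv x) p / L) \<and>
    (\<forall>x y. up_step G S \<rho> C x y \<longrightarrow> \<rho> (inv x) p < \<rho> (inv y) p)"
proof -
  have ap: "almost_periodic G S \<rho>" using assms by (simp add: up_uniform_def)
  obtain C where C: "1 \<le> C" and conf: "\<And>x y. x \<in> carrier G \<Longrightarrow> y \<in> carrier G \<Longrightarrow> d x y \<le> 2 * C \<Longrightarrow>
       \<exists>z. (up_step G S \<rho> C)\<^sup>*\<^sup>* x z \<and> (up_step G S \<rho> C)\<^sup>*\<^sup>* y z"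
    using up_uniform_confluent[OF assms] by blast
  obtain c where c: "0 < c" "\<And>x y p. up_step G S \<rho> C x y \<Longrightarrow> \<rho> (inv x) p + c \<le> \<rho> (inv y) p"
    using up_step_height[of \<rho> C] ap by (auto simp: almost_periodic_def orientation_preserving_action_def)
  obtain L where L: "0 < L"
    "\<And>x y p. x \<in> carrier G \<Longrightarrow> y \<in> carrier G \<Longrightarrow> \<bar>\<rho> (inv x) p - \<rho> (inv y) p\<bar> \<le> L * d x y"
    using almost_periodic_lipschitz[OF ap] by blast
  have "hyperbolic_up_steps G S (up_step G S \<rho> C) C (c / L) (\<lambda>x. \<rho> (inv x) p / L)"
  proof
    show "0 < c / L" using c L by simp
    show "\<rho> (inv x) p / L + c / L \<le> \<rho> (inv y) p / L" if "up_step G S \<rho> C x y" for x y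
      using c(2)[OF that, of p] L(1) by (simp add: add_divide_distrib[symmetric] divide_right_mono)
    show "\<bar>\<rho> (inv x) p / L - \<rho> (inv y) p / L\<bar> \<le> d x y" if "x \<in> carrier G" "y \<in> carrier G" for x y
    proof -
      have "\<bar>\<rho> (inv x) p / L - \<rho> (inv y) p / L\<bar> = \<bar>\<rho> (inv x) p - \<rho> (inv y) p\<bar> / L"
        using L(1) by (simp add: diff_divide_distrib[symmetric])
      also have "\<dots> \<le> d x y" using L(2)[OF that, of p] L(1) by (simp add: pos_divide_le_eq mult.commute)
      finally show ?thesis .
    qed
    show "\<exists>y. up_step G S \<rho> C x y" if "x \<in> carrier G" for x
      using up_step_serial[OF ap C conf that] .
  qed (use C conf up_step_translate in \<open>auto simp: up_step_def\<close>)
  moreover have "\<rho> (inv x) p < \<rho> (inv y) p" if "up_step G S \<rho> C x y" for x y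
    using c(1) c(2)[OF that, of p] by linarith
  ultimately show ?thesis using L(1) by blast
qed

section \<open>The zipper from the action and its opposite\<close>

theorem mainTheorem4:
  fixes G :: "('a, 'b) monoid_scheme" and S :: "'a set"
  assumes "hyperbolic_group G"
    and "symmetric_generating_set G S"
    and "\<exists>\<rho>. uniform_action G S \<rho>"
  shows "\<exists>Zp Zm. zipper G S Zp Zm"
proof -
  interpret group G using assms(1) by (simp add: hyperbolic_group_def)
  interpret hyperbolic_word_metric G S by unfold_locales (fact assms)+
  obtain \<rho> \<rho>' where \<rho>: "up_uniform G S \<rho>" and opp: "opposite_action \<rho> \<rho>'" and \<rho>': "up_uniform G S \<rho>'"
    using assms(3) unfolding uniform_action_def by blast
  obtain h h' where anti: "\<forall>p q. p < q \<longrightarrow> h q < h p" and conj: "\<rho>' = (\<lambda>g. h \<circ> \<rho> g \<circ> h')"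
    using opp unfolding opposite_action_def by (elim exE conjE)
  have anti_le: "p \<le> q" if "h q \<le> h p" for p q
    using anti[rule_format, of q p] that by (cases "q < p") auto
  \<comment> \<open>The base points are matched: \<open>\<rho>' g 0 = h (\<rho> g (h' 0))\<close>.
    Apart from positive factors, the opposite height is \<open>h\<close> of the other one, and
    \<open>h\<close> reverses the order, so each height decreases along the steps of the other
    action.\<close>
  obtain L C c where L: "0 < L"
    and up: "hyperbolic_up_steps G S (up_step G S \<rho> C) C c (\<lambda>x. \<rho> (inv\<^bsub>G\<^esub> x) (h' 0) / L)"
    and up_incr: "\<forall>x y. up_step G S \<rho> C x y \<longrightarrow> \<rho> (inv\<^bsub>G\<^esub> x) (h' 0) < \<rho> (inv\<^bsub>G\<^esub> y) (h' 0)"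
    using up_uniform_up_steps[OF \<rho>, of "h' 0"] by (elim exE conjE)
  obtain L' C' c' where L': "0 < L'"
    and down: "hyperbolic_up_steps G S (up_step G S \<rho>' C') C' c' (\<lambda>x. \<rho>' (inv\<^bsub>G\<^esub> x) 0 / L')"
    and down_incr: "\<forall>x y. up_step G S \<rho>' C' x y \<longrightarrow> \<rho>' (inv\<^bsub>G\<^esub> x) 0 < \<rho>' (inv\<^bsub>G\<^esub> y) 0"
    using up_uniform_up_steps[OF \<rho>', of 0] by (elim exE conjE)
  interpret up: hyperbolic_up_steps G S "up_step G S \<rho> C" C c "\<lambda>x. \<rho> (inv\<^bsub>G\<^esub> x) (h' 0) / L"
    by (fact up)
  interpret down: hyperbolic_up_steps G S "up_step G S \<rho>' C'" C' c' "\<lambda>x. \<rho>' (inv\<^bsub>G\<^esub> x) 0 / L'"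
    by (fact down)
  have "up.ray_ends \<inter> down.ray_ends = {}"
  proof (rule ray_ends_disjoint[OF up down])
    show "\<rho>' (inv\<^bsub>G\<^esub> y) 0 / L' \<le> \<rho>' (inv\<^bsub>G\<^esub> x) 0 / L'" if "up_step G S \<rho> C x y" for x y
      using anti[rule_format, OF up_incr[rule_format, OF that]] L' by (simp add: conj divide_right_mono)
    show "\<rho> (inv\<^bsub>G\<^esub> y) (h' 0) / L \<le> \<rho> (inv\<^bsub>G\<^esub> x) (h' 0) / L" if "up_step G S \<rho>' C' x y" for x y
      using down_incr[rule_format, OF that] L
      by (intro divide_right_mono[OF anti_le]) (simp_all add: conj)
  qed
  then have "zipper G S up.ray_ends down.ray_ends"
    by (simp add: zipper_def up.ray_ends_in_boundary down.ray_ends_in_boundary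
      up.ray_ends_nonempty down.ray_ends_nonempty up.path_connectedin_ray_ends
      down.path_connectedin_ray_ends up.ray_ends_invariant down.ray_ends_invariant)
  then show ?thesis by blast
qed

end
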